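(* If $m,y$ are positive integers such that at least one of the following holds: (a) $m=4$ and $y\geq 4$; or (b) $m=5$ and $y\geq 3$; or (c) $m\geq 6$ and $y\geq 2$, then there exists a non-negative homogeneous polynomial with real coefficients in $m$ variables of degree $2y$ that is not a hyperwron.
   Context: $F_{m,k}$ denotes the real vector space of homogeneous polynomials (forms) of degree $k$ in $m$ real variables with real coefficients (including $0$). A form $q\in F_{m,2y}$ is non-negative if $q(x)\ge 0$ for all $x\in\mathbb{R}^m$. A form $p\in F_{n,d}$ is hyperbolic with respect to $e\in\mathbb{R}^n$ if $p(e)>0$ and for every $x\in\mathbb{R}^n$ the univariate polynomial $t\mapsto p(te-x)$ has only real roots; $\mathrm{Hyp}_{n,d}(e)$ is the set of such $p$. The associated (closed) hyperbolicity cone $\Lambda_+(p,e)$ is the set of $x\in\mathbb{R}^n$ such that all roots of $t\mapsto p(te-x)$ are non-negative. $D_ap(x)=\frac{d}{dt}p(x+ta)|_{t=0}$ is the directional derivative and $D^2_{ab}p=D_aD_bp$. $F_{m,k}^n$ is the set of $n$-tuples of elements of $F_{m,k}$, viewed as polynomial maps $\mathbb{R}^m\to\mathbb{R}^n$. A form $q\in F_{m,2y}$ is a hyperwron (has a hyperbolic-Wronskian certificate of non-negativity) if there exist positive integers $k,d,n$, a vector $e\in\mathbb{R}^n$, a hyperbolic polynomial $p\in\mathrm{Hyp}_{n,d}(e)$, points $u,v\in\Lambda_+(p,e)$ and a map $\phi\in F_{m,k}^n$ such that $$q(x)=D_up(\phi(x))\,D_vp(\phi(x))-p(\phi(x))\,D^2_{uv}p(\phi(x)).$$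 *)

theory Defs
  imports "HOL-Analysis.Analysis" "HOL-Library.Poly_Mapping"
begin

text \<open>
  A polynomial with real coefficients in the variables \<open>X\<^sub>0, X\<^sub>1, \<dots>\<close> is a finitely
  supported map from exponent vectors (themselves finitely supported) to coefficients.
\<close>

type_synonym rpoly = "(nat \<Rightarrow>\<^sub>0 nat) \<Rightarrow>\<^sub>0 real"

text \<open>
  Evaluation is polymorphic so that a real polynomial can be evaluated both at real and at
  complex arguments.
\<close>

definition peval :: "rpoly \<Rightarrow> (nat \<Rightarrow> 'a::{real_algebra_1,comm_ring_1}) \<Rightarrow> 'a" where
  "peval p x = (\<Sum>\<alpha>\<in>Poly_Mapping.keys p. of_real (Poly_Mapping.lookup p \<alpha>) *
      (\<Prod>i\<in>Poly_Mapping.keys \<alpha>. x i ^ Poly_Mapping.lookup \<alpha> i))"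

definition forms :: "nat \<Rightarrow> nat \<Rightarrow> rpoly set" where
  "forms m k = {p. \<forall>\<alpha>\<in>Poly_Mapping.keys p. Poly_Mapping.keys \<alpha> \<subseteq> {..<m} \<and>
      (\<Sum>i\<in>Poly_Mapping.keys \<alpha>. Poly_Mapping.lookup \<alpha> i) = k}"

text \<open>
  \<open>\<real>\<^sup>n\<close> for variable \<open>n\<close>: coordinates \<open>0, \<dots>, n - 1\<close>, padded with zeros. This is the
  carrier of the library's \<^const>\<open>Euclidean_space\<close>.
\<close>

definition Rn :: "nat \<Rightarrow> (nat \<Rightarrow> real) set" where
  "Rn n = {x. \<forall>i\<ge>n. x i = 0}"

definition nonneg_form :: "nat \<Rightarrow> rpoly \<Rightarrow> bool" where
  "nonneg_form m q \<longleftrightarrow> (\<forall>x\<in>Rn m. peval q x \<ge> 0)"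

text \<open>
  ``Only real roots'' is a condition on the complex roots of the univariate polynomial.
\<close>

definition Hyp :: "nat \<Rightarrow> nat \<Rightarrow> (nat \<Rightarrow> real) \<Rightarrow> rpoly set" where
  "Hyp n d e = {p \<in> forms n d. peval p e > 0 \<and>
      (\<forall>x\<in>Rn n. \<forall>t::complex.
         peval p (\<lambda>i. t * of_real (e i) - of_real (x i)) = 0 \<longrightarrow> t \<in> \<real>)}"

text \<open>
  For \<open>p \<in> Hyp n d e\<close> all roots are real, so real \<open>t\<close> suffice here.
\<close>

definition hyp_cone :: "nat \<Rightarrow> rpoly \<Rightarrow> (nat \<Rightarrow> real) \<Rightarrow> (nat \<Rightarrow> real) set" where
  "hyp_cone n p e = {x \<in> Rn n. \<forall>t::real. peval p (\<lambda>i. t * e i - x i) = 0 \<longrightarrow> t \<ge> 0}"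

definition dirderiv ::
    "(nat \<Rightarrow> real) \<Rightarrow> ((nat \<Rightarrow> real) \<Rightarrow> real) \<Rightarrow> (nat \<Rightarrow> real) \<Rightarrow> real" where
  "dirderiv a f x = deriv (\<lambda>t. f (\<lambda>i. x i + t * a i)) 0"

definition poly_map :: "nat \<Rightarrow> (nat \<Rightarrow> rpoly) \<Rightarrow> (nat \<Rightarrow> real) \<Rightarrow> nat \<Rightarrow> real" where
  "poly_map n \<phi> x = (\<lambda>i. if i < n then peval (\<phi> i) x else 0)"

definition hyperwron :: "nat \<Rightarrow> rpoly \<Rightarrow> bool" where
  "hyperwron m q \<longleftrightarrow>
     (\<exists>k d n :: nat. \<exists>e p u v \<phi>.
        k > 0 \<and> d > 0 \<and> n > 0 \<and>
        e \<in> Rn n \<and> p \<in> Hyp n d e \<and>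
        u \<in> hyp_cone n p e \<and> v \<in> hyp_cone n p e \<and>
        (\<forall>i<n. \<phi> i \<in> forms m k) \<and>
        (\<forall>x\<in>Rn m. let z = poly_map n \<phi> x in
           peval q x = dirderiv u (peval p) z * dirderiv v (peval p) z
             - peval p z * dirderiv u (dirderiv v (peval p)) z))"

end

theory Submission imports Defs begin

text \<open>
  Write \<open>a = D\<^sub>u p \<circ> \<phi>\<close>, \<open>b = D\<^sub>v p \<circ> \<phi>\<close>, \<open>f = p \<circ> \<phi>\<close> and \<open>h = D\<^sub>u D\<^sub>v p \<circ> \<phi>\<close>.
  A hyperwron is \<open>q = a b - f h\<close>, where \<open>a\<close> and \<open>b\<close> are forms of degree \<open>y = k (d - 1)\<close>, \<open>f\<close> has
  degree \<open>y + k\<close> and \<open>h\<close> has degree \<open>y - k\<close>. The proof confronts this with two separate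
  obstructions, according to the degree \<open>d\<close> of \<open>p\<close>; for \<open>d = 1\<close> the form \<open>q\<close> would be constant.

  If \<open>d \<ge> 3\<close>, then \<open>2 k \<le> y\<close>, and forms of the shape \<open>a b - f h\<close> depend on fewer coefficients than a
  form of degree \<open>2 y\<close> has, by the hypothesis on \<open>m\<close> and \<open>y\<close>
  (\<open>card_exps_product_lt\<close>, for at most six variables). Hence every box in the space of forms contains a form that is not of
  this shape. The usual argument is that a polynomial map into a space of larger dimension has
  negligible image. Here it is replaced by linear algebra (\<open>quadratic_images_miss_box\<close>): if a
  grid of \<open>T\<^sup>M\<close> points were contained in the image of \<open>N < M\<close> parameters, then the indicator
  functions of the grid points would be forms in the parameters of a degree proportional to
  \<open>T\<close>, and there are only about \<open>T\<^sup>N\<close> monomials to span them. For \<open>m > 6\<close> everything is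
  restricted to the first six variables.

  If \<open>d = 2\<close>, then the Wronskian of \<open>p\<close> is a quadratic form, and it is positive semidefinite because
  \<open>p\<close> has Lorentzian signature and \<open>u, v\<close> lie in its forward cone
  (\<open>hyperbolic_quadratic_wronskian\<close>). So \<open>q\<close> is in effect a sum of squares of forms of degree \<open>y\<close>.
  Such a \<open>q\<close> obeys a Cayley--Bacharach inequality: mixed finite differences annihilate forms of
  degree \<open>y\<close> on the grid \<open>{0,\<dots>,y-1} \<times> {0,1} \<times> {0,1}\<close>, so the value of a form at the corner
  \<open>(0,0,0)\<close> is a combination of its values at the other grid points, and \<open>q\<close> at the corner is at most
  a constant times the sum of its values at the other points.

  A quartic of Choi and Lam, in coordinates in which its seven zeros are seven of the
  vertices of a cube, multiplied by squares of linear forms, gives a non-negative form that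
  vanishes on the grid except at the corner. It violates the inequality, and so does each
  sufficiently close form. Adding a small positive definite form makes room for a whole box of
  non-negative forms with this property, and the box contains a form that is not of the shape
  \<open>a b - f h\<close>.
\<close>

section \<open>Forms as functions\<close>

definition exps :: "nat \<Rightarrow> nat \<Rightarrow> (nat \<Rightarrow> nat) set" where
  "exps m k = {\<beta>. (\<forall>i\<ge>m. \<beta> i = 0) \<and> (\<Sum>i<m. \<beta> i) = k}"

text \<open>
  Monomials are polymorphic because hyperbolicity evaluates a form at complex arguments.
\<close>

definition mon :: "nat \<Rightarrow> (nat \<Rightarrow> nat) \<Rightarrow> (nat \<Rightarrow> 'a::comm_semiring_1) \<Rightarrow> 'a" where
  "mon m \<beta> x = (\<Prod>i<m. x i ^ \<beta> i)"

text \<open>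
  Being a form is a property of a function on \<open>\<real>\<^sup>m\<close> here. This makes closure under products,
  composition and directional derivatives easy to express, and no condition is imposed outside \<^term>\<open>Rn m\<close>,
  where the maps built from \<^const>\<open>poly_map\<close> never take values.
\<close>

definition hform :: "nat \<Rightarrow> nat \<Rightarrow> ((nat \<Rightarrow> real) \<Rightarrow> real) \<Rightarrow> bool" where
  "hform m k f \<longleftrightarrow> (\<exists>c. \<forall>x\<in>Rn m. f x = (\<Sum>\<beta>\<in>exps m k. c \<beta> * mon m \<beta> x))"

lemma exps_le:
  assumes "\<beta> \<in> exps m k"
  shows "\<beta> i \<le> k"
proof (cases "i < m")
  case True
  then have "\<beta> i \<le> (\<Sum>i<m. \<beta> i)" by (intro member_le_sum) auto
  then show ?thesis using assms by (simp add: exps_def)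
qed (use assms in \<open>auto simp: exps_def\<close>)

lemma finite_exps [simp, intro]: "finite (exps m k)"
proof -
  have "exps m k \<subseteq> {f. \<forall>i. (i \<in> {..<m} \<longrightarrow> f i \<in> {..k}) \<and> (i \<notin> {..<m} \<longrightarrow> f i = 0)}"
    using exps_le by (auto simp: exps_def)
  then show ?thesis
    by (rule finite_subset) (intro finite_set_of_finite_funs; simp)
qed

text \<open>
  An exponent vector is a list of length \<open>m\<close> with sum \<open>k\<close>; the library counts those.
\<close>

lemma card_exps: "card (exps m k) = (k + m - 1) choose k"
proof -
  have "bij_betw (\<lambda>\<beta>. map \<beta> [0..<m]) (exps m k) {l. length l = m \<and> sum_list l = k}"
  proof (rule bij_betw_byWitness[where f' = "\<lambda>l i. if i < m then l ! i else 0"])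
    show "\<forall>\<beta>\<in>exps m k. (\<lambda>i. if i < m then map \<beta> [0..<m] ! i else 0) = \<beta>"
      by (auto simp: exps_def fun_eq_iff)
    show "\<forall>l\<in>{l. length l = m \<and> sum_list l = k}.
        map (\<lambda>i. if i < m then l ! i else 0) [0..<m] = l"
      by (auto intro!: nth_equalityI)
    show "(\<lambda>\<beta>. map \<beta> [0..<m]) ` exps m k \<subseteq> {l. length l = m \<and> sum_list l = k}"
      by (auto simp: exps_def sum_list_sum_nth atLeast0LessThan)
    show "(\<lambda>l i. if i < m then l ! i else 0) ` {l. length l = m \<and> sum_list l = k} \<subseteq> exps m k"
      by (auto simp: exps_def sum_list_sum_nth atLeast0LessThan)
  qed
  then show ?thesis using card_length_sum_list[of m k] by (simp add: bij_betw_same_card)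
qed

lemma mon_add: "mon m (\<lambda>i. \<beta> i + \<gamma> i) x = mon m \<beta> x * mon m \<gamma> x"
  by (simp add: mon_def power_add prod.distrib)

lemma exps_add: "\<beta> \<in> exps m k \<Longrightarrow> \<gamma> \<in> exps m l \<Longrightarrow> (\<lambda>i. \<beta> i + \<gamma> i) \<in> exps m (k + l)"
  by (simp add: exps_def sum.distrib)

lemma hformI:
  assumes "\<And>x. x \<in> Rn m \<Longrightarrow> f x = (\<Sum>\<beta>\<in>exps m k. c \<beta> * mon m \<beta> x)"
  shows "hform m k f"
  using assms unfolding hform_def by blast

lemma hform_cong:
  assumes "hform m k f" "\<And>x. x \<in> Rn m \<Longrightarrow> g x = f x"
  shows "hform m k g"
  using assms unfolding hform_def by auto

lemma hform_zero: "hform m k (\<lambda>_. 0)"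
  by (rule hformI[where c = "\<lambda>_. 0"]) simp

lemma hform_mon:
  assumes "\<beta> \<in> exps m k"
  shows "hform m k (mon m \<beta>)"
proof (rule hformI[where c = "\<lambda>\<gamma>. if \<gamma> = \<beta> then 1 else 0"])
  fix x :: "nat \<Rightarrow> real"
  show "mon m \<beta> x = (\<Sum>\<gamma>\<in>exps m k. (if \<gamma> = \<beta> then 1 else 0) * mon m \<gamma> x)"
    using assms by (simp add: if_distrib[of "\<lambda>u. u * _"] cong: if_cong)
qed

lemma hform_cmult:
  assumes "hform m k f"
  shows "hform m k (\<lambda>x. a * f x)"
proof -
  obtain c where "\<And>x. x \<in> Rn m \<Longrightarrow> f x = (\<Sum>\<beta>\<in>exps m k. c \<beta> * mon m \<beta> x)"
    using assms unfolding hform_def by blast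
  then show ?thesis
    by (intro hformI[where c = "\<lambda>\<beta>. a * c \<beta>"]) (simp add: sum_distrib_left mult.assoc)
qed

lemma hform_add:
  assumes "hform m k f" "hform m k g"
  shows "hform m k (\<lambda>x. f x + g x)"
proof -
  obtain c where "\<And>x. x \<in> Rn m \<Longrightarrow> f x = (\<Sum>\<beta>\<in>exps m k. c \<beta> * mon m \<beta> x)"
    using assms unfolding hform_def by blast
  moreover obtain d where "\<And>x. x \<in> Rn m \<Longrightarrow> g x = (\<Sum>\<beta>\<in>exps m k. d \<beta> * mon m \<beta> x)"
    using assms unfolding hform_def by blast
  ultimately show ?thesis
    by (intro hformI[where c = "\<lambda>\<beta>. c \<beta> + d \<beta>"]) (simp add: sum.distrib distrib_right)
qed

lemma hform_diff:
  assumes "hform m k f" "hform m k g"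
  shows "hform m k (\<lambda>x. f x - g x)"
  using hform_add[OF assms(1) hform_cmult[OF assms(2), of "-1"]] by simp

lemma hform_sum:
  assumes "\<And>i. i \<in> A \<Longrightarrow> hform m k (f i)"
  shows "hform m k (\<lambda>x. \<Sum>i\<in>A. f i x)"
  using assms
  by (induction A rule: infinite_finite_induct) (auto intro: hform_zero hform_add)

lemma hform_mult:
  assumes "hform m k f" "hform m l g"
  shows "hform m (k + l) (\<lambda>x. f x * g x)"
proof -
  obtain c where c: "\<And>x. x \<in> Rn m \<Longrightarrow> f x = (\<Sum>\<beta>\<in>exps m k. c \<beta> * mon m \<beta> x)"
    using assms unfolding hform_def by blast
  obtain d where d: "\<And>x. x \<in> Rn m \<Longrightarrow> g x = (\<Sum>\<beta>\<in>exps m l. d \<beta> * mon m \<beta> x)"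
    using assms unfolding hform_def by blast
  have "hform m (k + l) (\<lambda>x. \<Sum>\<beta>\<in>exps m k. \<Sum>\<gamma>\<in>exps m l.
      (c \<beta> * d \<gamma>) * mon m (\<lambda>i. \<beta> i + \<gamma> i) x)"
    by (intro hform_sum hform_cmult hform_mon exps_add)
  then show ?thesis
    by (rule hform_cong) (simp add: c d mon_add sum_product algebra_simps)
qed

lemma hform_const: "hform m 0 (\<lambda>_. a)"
proof -
  have "hform m 0 (\<lambda>x. a * mon m (\<lambda>_. 0) x)"
    by (intro hform_cmult hform_mon) (simp add: exps_def)
  then show ?thesis by (simp add: mon_def)
qed

lemma hform_prod:
  assumes "\<And>i. i \<in> A \<Longrightarrow> hform m (d i) (f i)"
  shows "hform m (\<Sum>i\<in>A. d i) (\<lambda>x. \<Prod>i\<in>A. f i x)"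
  using assms
  by (induction A rule: infinite_finite_induct) (auto intro: hform_const hform_mult)

lemma hform_power: "hform m k f \<Longrightarrow> hform m (k * j) (\<lambda>x. f x ^ j)"
  using hform_prod[of "{..<j}" m "\<lambda>_. k" "\<lambda>_. f"] by (simp add: mult.commute)

lemma mon_unit:
  assumes "i < m"
  shows "mon m (\<lambda>j. if j = i then 1 else 0) x = x i"
  using assms by (simp add: mon_def if_distrib[of "\<lambda>u. _ ^ u"] cong: if_cong)

lemma hform_coord:
  assumes "i < m"
  shows "hform m 1 (\<lambda>x. x i)"
proof -
  have "hform m 1 (mon m (\<lambda>j. if j = i then 1 else 0))"
    using assms by (intro hform_mon) (simp add: exps_def)
  then show ?thesis unfolding mon_unit[OF assms] .
qed

lemma hform_scale:
  assumes "hform m k f" "x \<in> Rn m"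
  shows "f (\<lambda>i. t * x i) = t ^ k * f x"
proof -
  obtain c where c: "\<And>x. x \<in> Rn m \<Longrightarrow> f x = (\<Sum>\<beta>\<in>exps m k. c \<beta> * mon m \<beta> x)"
    using assms unfolding hform_def by blast
  have tx: "(\<lambda>i. t * x i) \<in> Rn m" using assms(2) by (simp add: Rn_def)
  have "mon m \<beta> (\<lambda>i. t * x i) = t ^ k * mon m \<beta> x" if "\<beta> \<in> exps m k" for \<beta>
    using that by (simp add: mon_def exps_def power_mult_distrib prod.distrib flip: power_sum)
  then show ?thesis
    by (simp add: c[OF tx] c[OF assms(2)] sum_distrib_left mult.left_commute)
qed

lemma hform_compose:
  assumes "hform n d f" "\<And>i. i < n \<Longrightarrow> hform m k (\<phi> i)"
  shows "hform m (k * d) (\<lambda>x. f (\<lambda>i. if i < n then \<phi> i x else 0))"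
proof -
  obtain c where c: "\<And>x. x \<in> Rn n \<Longrightarrow> f x = (\<Sum>\<beta>\<in>exps n d. c \<beta> * mon n \<beta> x)"
    using assms unfolding hform_def by blast
  have "hform m (k * d) (\<lambda>x. \<Prod>i<n. \<phi> i x ^ \<beta> i)" if "\<beta> \<in> exps n d" for \<beta>
  proof -
    have "hform m (\<Sum>i<n. k * \<beta> i) (\<lambda>x. \<Prod>i<n. \<phi> i x ^ \<beta> i)"
      using assms(2) by (intro hform_prod hform_power) auto
    then show ?thesis using that by (simp add: exps_def flip: sum_distrib_left)
  qed
  then have "hform m (k * d) (\<lambda>x. \<Sum>\<beta>\<in>exps n d. c \<beta> * (\<Prod>i<n. \<phi> i x ^ \<beta> i))"
    by (intro hform_sum hform_cmult)
  then show ?thesis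
    by (rule hform_cong) (simp add: c Rn_def mon_def)
qed

lemma hform_extend:
  assumes "hform m k f" "m \<le> m'"
  shows "hform m' k (\<lambda>x. f (\<lambda>i. if i < m then x i else 0))"
proof -
  have "hform m' 1 (\<lambda>x. x i)" if "i < m" for i
    using that assms(2) by (intro hform_coord) simp
  then show ?thesis using hform_compose[OF assms(1), of m' 1 "\<lambda>i x. x i"] by simp
qed

text \<open>
  Setting the last variables to zero kills the monomials that contain them and changes nothing else.
\<close>

lemma hform_restrict:
  assumes "hform m k f" "m' \<le> m"
  shows "hform m' k f"
proof -
  obtain c where c: "\<And>x. x \<in> Rn m \<Longrightarrow> f x = (\<Sum>\<beta>\<in>exps m k. c \<beta> * mon m \<beta> x)"
    using assms unfolding hform_def by blast
  have split: "{..<m} = {..<m'} \<union> {m'..<m}" using assms(2) by auto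
  have sub: "exps m' k \<subseteq> exps m k"
  proof
    fix \<beta> assume \<beta>: "\<beta> \<in> exps m' k"
    have "(\<Sum>i<m. \<beta> i) = (\<Sum>i<m'. \<beta> i)"
      using \<beta> by (intro sum.mono_neutral_right) (auto simp: split exps_def)
    then show "\<beta> \<in> exps m k" using \<beta> assms(2) by (auto simp: exps_def)
  qed
  show ?thesis
  proof (rule hformI[where c = c])
    fix x assume x: "x \<in> Rn m'"
    have xm: "x \<in> Rn m" using x assms(2) by (simp add: Rn_def)
    have "(\<Sum>\<beta>\<in>exps m k. c \<beta> * mon m \<beta> x) = (\<Sum>\<beta>\<in>exps m' k. c \<beta> * mon m' \<beta> x)"
    proof (rule sum.mono_neutral_cong_right)
      show "\<forall>\<beta>\<in>exps m k - exps m' k. c \<beta> * mon m \<beta> x = 0"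
      proof
        fix \<beta> assume \<beta>: "\<beta> \<in> exps m k - exps m' k"
        have "\<exists>i. m' \<le> i \<and> i < m \<and> \<beta> i \<noteq> 0"
        proof (rule ccontr)
          assume no: "\<not> ?thesis"
          have "(\<Sum>i<m. \<beta> i) = (\<Sum>i<m'. \<beta> i)"
            using no by (intro sum.mono_neutral_right) (auto simp: split)
          moreover have "\<forall>i\<ge>m'. \<beta> i = 0"
            using no \<beta> unfolding exps_def by (metis (mono_tags, lifting) DiffD1 mem_Collect_eq not_le)
          ultimately show False using \<beta> by (auto simp: exps_def)
        qed
        then show "c \<beta> * mon m \<beta> x = 0"
          using x by (auto simp: mon_def Rn_def intro!: prod_zero)
      qed
      show "c \<beta> * mon m \<beta> x = c \<beta> * mon m' \<beta> x" if "\<beta> \<in> exps m' k" for \<beta>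
      proof -
        have "(\<Prod>i<m. x i ^ \<beta> i) = (\<Prod>i<m'. x i ^ \<beta> i)"
          using that by (intro prod.mono_neutral_right) (auto simp: split exps_def)
        then show ?thesis by (simp add: mon_def)
      qed
    qed (use sub in auto)
    then show "f x = (\<Sum>\<beta>\<in>exps m' k. c \<beta> * mon m' \<beta> x)" using c[OF xm] by simp
  qed
qed

lemma DERIV_mon_line:
  "((\<lambda>t. mon n \<beta> (\<lambda>i. x i + t * a i)) has_field_derivative
     (\<Sum>i<n. real (\<beta> i) * a i * mon n (\<beta>(i := \<beta> i - 1)) x)) (at 0)"
  for x a :: "nat \<Rightarrow> real"
proof -
  have "((\<lambda>t. \<Prod>i<n. (x i + t * a i) ^ \<beta> i) has_field_derivative
     (\<Sum>i<n. (real (\<beta> i) * x i ^ (\<beta> i - 1) * a i) * (\<Prod>j\<in>{..<n}-{i}. (x j + 0 * a j) ^ \<beta> j))) (at 0)"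
    by (rule has_field_derivative_prod) (auto intro!: derivative_eq_intros)
  moreover have "(real (\<beta> i) * x i ^ (\<beta> i - 1) * a i) * (\<Prod>j\<in>{..<n}-{i}. (x j + 0 * a j) ^ \<beta> j)
      = real (\<beta> i) * a i * mon n (\<beta>(i := \<beta> i - 1)) x" if "i < n" for i
  proof -
    have "mon n (\<beta>(i := \<beta> i - 1)) x = x i ^ (\<beta> i - 1) * (\<Prod>j\<in>{..<n}-{i}. x j ^ \<beta> j)"
      using that by (simp add: mon_def prod.remove[of "{..<n}" i])
    then show ?thesis by simp
  qed
  then have "(\<Sum>i<n. (real (\<beta> i) * x i ^ (\<beta> i - 1) * a i) * (\<Prod>j\<in>{..<n}-{i}. (x j + 0 * a j) ^ \<beta> j))
      = (\<Sum>i<n. real (\<beta> i) * a i * mon n (\<beta>(i := \<beta> i - 1)) x)"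
    by (intro sum.cong) auto
  ultimately show ?thesis by (simp only: mon_def)
qed

lemma DERIV_hform_line:
  assumes "\<And>x. x \<in> Rn n \<Longrightarrow> f x = (\<Sum>\<beta>\<in>exps n d. c \<beta> * mon n \<beta> x)" "a \<in> Rn n" "x \<in> Rn n"
  shows "((\<lambda>t. f (\<lambda>i. x i + t * a i)) has_field_derivative
     (\<Sum>\<beta>\<in>exps n d. c \<beta> * (\<Sum>i<n. real (\<beta> i) * a i * mon n (\<beta>(i := \<beta> i - 1)) x))) (at 0)"
proof -
  have "(\<lambda>i. x i + t * a i) \<in> Rn n" for t using assms(2,3) by (simp add: Rn_def)
  then have "f (\<lambda>i. x i + t * a i) = (\<Sum>\<beta>\<in>exps n d. c \<beta> * mon n \<beta> (\<lambda>i. x i + t * a i))" for t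
    by (rule assms(1))
  then show ?thesis
    by (simp only:) (intro DERIV_sum DERIV_cmult DERIV_mon_line)
qed

text \<open>
  The derivative of a monomial along \<open>a\<close> is the sum of \<open>\<beta>\<^sub>i a\<^sub>i\<close> times the monomial with the exponent of
  \<open>x\<^sub>i\<close> lowered. Where that exponent is zero the factor \<open>\<beta>\<^sub>i\<close> vanishes, so truncated
  subtraction does no harm, also for \<open>d = 0\<close>.
\<close>

lemma hform_dirderiv:
  assumes "hform n d f" "a \<in> Rn n"
  shows "hform n (d - 1) (dirderiv a f)"
proof -
  obtain c where c: "\<And>x. x \<in> Rn n \<Longrightarrow> f x = (\<Sum>\<beta>\<in>exps n d. c \<beta> * mon n \<beta> x)"
    using assms unfolding hform_def by blast
  have low: "hform n (d - 1) (\<lambda>x. real (\<beta> i) * a i * mon n (\<beta>(i := \<beta> i - 1)) x)"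
    if "\<beta> \<in> exps n d" "i < n" for \<beta> i
  proof (cases "\<beta> i = 0")
    case True
    then show ?thesis by (simp add: hform_zero)
  next
    case False
    have "(\<Sum>j<n. (\<beta>(i := \<beta> i - 1)) j) = (\<beta> i - 1) + (\<Sum>j\<in>{..<n}-{i}. \<beta> j)"
      using that(2) by (simp add: sum.remove[of "{..<n}" i])
    moreover have "d = \<beta> i + (\<Sum>j\<in>{..<n}-{i}. \<beta> j)"
      using that by (simp add: exps_def sum.remove[of "{..<n}" i])
    ultimately have "\<beta>(i := \<beta> i - 1) \<in> exps n (d - 1)"
      using that False by (simp add: exps_def)
    then show ?thesis by (intro hform_cmult hform_mon)
  qed
  have "hform n (d - 1) (\<lambda>x. \<Sum>\<beta>\<in>exps n d. c \<beta> *
      (\<Sum>i<n. real (\<beta> i) * a i * mon n (\<beta>(i := \<beta> i - 1)) x))"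
    by (intro hform_sum hform_cmult low) auto
  then show ?thesis
    by (rule hform_cong)
      (simp add: dirderiv_def DERIV_imp_deriv[OF DERIV_hform_line[OF c assms(2)]])
qed

lemma dirderiv_degree_0:
  assumes "hform n 0 f" "a \<in> Rn n" "x \<in> Rn n"
  shows "dirderiv a f x = 0"
proof -
  obtain c where c: "\<And>x. x \<in> Rn n \<Longrightarrow> f x = (\<Sum>\<beta>\<in>exps n 0. c \<beta> * mon n \<beta> x)"
    using assms unfolding hform_def by blast
  have "(\<Sum>i<n. real (\<beta> i) * a i * mon n (\<beta>(i := \<beta> i - 1)) x) = 0" if "\<beta> \<in> exps n 0" for \<beta>
  proof -
    have "\<beta> i = 0" for i using exps_le[OF that, of i] by simp
    then show ?thesis by simp
  qed
  then have "(\<Sum>\<beta>\<in>exps n 0. c \<beta> * (\<Sum>i<n. real (\<beta> i) * a i * mon n (\<beta>(i := \<beta> i - 1)) x)) = 0"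
    by (intro sum.neutral ballI) (simp only: mult_zero_right)
  then show ?thesis
    by (simp only: dirderiv_def DERIV_imp_deriv[OF DERIV_hform_line[OF c assms(2,3)]])
qed

lemma lookup_exps:
  "Poly_Mapping.keys \<alpha> \<subseteq> {..<m} \<and> (\<Sum>i\<in>Poly_Mapping.keys \<alpha>. Poly_Mapping.lookup \<alpha> i) = k
    \<longleftrightarrow> Poly_Mapping.lookup \<alpha> \<in> exps m k"
proof -
  have 1: "Poly_Mapping.keys \<alpha> \<subseteq> {..<m} \<longleftrightarrow> (\<forall>i\<ge>m. Poly_Mapping.lookup \<alpha> i = 0)"
    unfolding subset_iff in_keys_iff lessThan_iff by (meson not_less)
  have "(\<Sum>i\<in>Poly_Mapping.keys \<alpha>. Poly_Mapping.lookup \<alpha> i) = (\<Sum>i<m. Poly_Mapping.lookup \<alpha> i)"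
    if "Poly_Mapping.keys \<alpha> \<subseteq> {..<m}"
    using that by (intro sum.mono_neutral_left) (auto simp: in_keys_iff)
  then show ?thesis using 1 by (auto simp: exps_def)
qed

lemma lookup_Abs_exps [simp]:
  assumes "\<beta> \<in> exps m k"
  shows "Poly_Mapping.lookup (Abs_poly_mapping \<beta>) = \<beta>"
proof (rule lookup_Abs_poly_mapping)
  have "{i. \<beta> i \<noteq> 0} \<subseteq> {..<m}" using assms unfolding exps_def by (auto simp: not_less[symmetric])
  then show "finite {i. \<beta> i \<noteq> 0}" by (rule finite_subset) simp
qed

lemma peval_forms:
  fixes x :: "nat \<Rightarrow> 'a::{real_algebra_1,comm_ring_1}"
  assumes "p \<in> forms m k"
  shows "peval p x =
    (\<Sum>\<beta>\<in>exps m k. of_real (Poly_Mapping.lookup p (Abs_poly_mapping \<beta>)) * mon m \<beta> x)"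
proof -
  let ?h = "\<lambda>\<alpha>. of_real (Poly_Mapping.lookup p \<alpha>) *
      (\<Prod>i\<in>Poly_Mapping.keys \<alpha>. x i ^ Poly_Mapping.lookup \<alpha> i)"
  have inj: "inj_on Abs_poly_mapping (exps m k)"
    by (rule inj_onI) (metis lookup_Abs_exps)
  have "peval p x = sum ?h (Abs_poly_mapping ` exps m k)"
    unfolding peval_def
  proof (rule sum.mono_neutral_left)
    show "Poly_Mapping.keys p \<subseteq> Abs_poly_mapping ` exps m k"
    proof
      fix \<alpha> assume "\<alpha> \<in> Poly_Mapping.keys p"
      then have "Poly_Mapping.lookup \<alpha> \<in> exps m k"
        using assms by (simp add: forms_def flip: lookup_exps)
      then show "\<alpha> \<in> Abs_poly_mapping ` exps m k"
        by (metis image_eqI lookup_inverse)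
    qed
  qed (auto simp: in_keys_iff)
  also have "\<dots> = (\<Sum>\<beta>\<in>exps m k. ?h (Abs_poly_mapping \<beta>))"
    using inj by (simp add: sum.reindex)
  also have "\<dots> = (\<Sum>\<beta>\<in>exps m k. of_real (Poly_Mapping.lookup p (Abs_poly_mapping \<beta>)) * mon m \<beta> x)"
  proof (rule sum.cong)
    fix \<beta> assume \<beta>: "\<beta> \<in> exps m k"
    have "(\<Prod>i\<in>Poly_Mapping.keys (Abs_poly_mapping \<beta>). x i ^ \<beta> i) = mon m \<beta> x"
      unfolding mon_def
      using \<beta> lookup_exps[of "Abs_poly_mapping \<beta>" m k]
      by (intro prod.mono_neutral_left) (auto simp: in_keys_iff)
    then show "?h (Abs_poly_mapping \<beta>)
        = of_real (Poly_Mapping.lookup p (Abs_poly_mapping \<beta>)) * mon m \<beta> x"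
      using \<beta> by simp
  qed simp
  finally show ?thesis .
qed

lemma hform_peval: "p \<in> forms m k \<Longrightarrow> hform m k (peval p)"
  by (rule hformI) (simp add: peval_forms)

lemma forms_of_hform:
  assumes "hform m k f"
  shows "\<exists>q\<in>forms m k. \<forall>x\<in>Rn m. peval q x = f x"
proof -
  obtain c where c: "\<And>x. x \<in> Rn m \<Longrightarrow> f x = (\<Sum>\<beta>\<in>exps m k. c \<beta> * mon m \<beta> x)"
    using assms unfolding hform_def by blast
  define q :: rpoly where
    "q = Abs_poly_mapping (\<lambda>\<alpha>. if Poly_Mapping.lookup \<alpha> \<in> exps m k
        then c (Poly_Mapping.lookup \<alpha>) else 0)"
  have "{\<alpha>. Poly_Mapping.lookup \<alpha> \<in> exps m k} \<subseteq> Abs_poly_mapping ` exps m k"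
    by (auto intro!: image_eqI simp: lookup_inverse)
  then have "finite {\<alpha>. Poly_Mapping.lookup \<alpha> \<in> exps m k}"
    by (rule finite_subset) simp
  then have lq: "Poly_Mapping.lookup q = (\<lambda>\<alpha>. if Poly_Mapping.lookup \<alpha> \<in> exps m k
        then c (Poly_Mapping.lookup \<alpha>) else 0)"
    unfolding q_def by (intro lookup_Abs_poly_mapping) (auto elim: rev_finite_subset)
  have q: "q \<in> forms m k"
    by (auto simp: forms_def lookup_exps in_keys_iff lq split: if_splits)
  then show ?thesis
    by (intro bexI[OF _ q]) (auto simp: peval_forms[OF q] c lq intro!: sum.cong)
qed

text \<open>
  Kronecker substitution: for \<open>x\<^sub>i = s^((k + 1)^i)\<close> the monomials become distinct powers of \<open>s\<close>, since
  exponents are at most \<open>k\<close> and hence are digits in base \<open>k + 1\<close>. So the claim reduces to polynomials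
  in one variable.
\<close>

lemma hform_coeffs_unique:
  assumes "\<And>x. x \<in> Rn m \<Longrightarrow>
      (\<Sum>\<beta>\<in>exps m k. c \<beta> * mon m \<beta> x) = (\<Sum>\<beta>\<in>exps m k. d \<beta> * mon m \<beta> x)"
    and "\<beta> \<in> exps m k"
  shows "c \<beta> = d \<beta>"
proof -
  define w where "w \<gamma> = (\<Sum>i<m. \<gamma> i * Suc k ^ i)" for \<gamma> :: "nat \<Rightarrow> nat"
  have digits: "\<forall>i<n. \<gamma> i = \<delta> i"
    if "\<forall>i<n. \<gamma> i \<le> k \<and> \<delta> i \<le> k" "(\<Sum>i<n. \<gamma> i * Suc k ^ i) = (\<Sum>i<n. \<delta> i * Suc k ^ i)"
    for n and \<gamma> \<delta> :: "nat \<Rightarrow> nat"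
    using that
  proof (induction n arbitrary: \<gamma> \<delta>)
    case (Suc n)
    have shift: "(\<Sum>i<Suc n. \<epsilon> i * Suc k ^ i) = \<epsilon> 0 + Suc k * (\<Sum>i<n. \<epsilon> (Suc i) * Suc k ^ i)" for \<epsilon>
      by (simp only: sum.lessThan_Suc_shift sum_distrib_left) (simp add: algebra_simps)
    have "\<gamma> 0 = \<delta> 0"
    proof -
      have "(\<Sum>i<Suc n. \<gamma> i * Suc k ^ i) mod Suc k = \<gamma> 0" "(\<Sum>i<Suc n. \<delta> i * Suc k ^ i) mod Suc k = \<delta> 0"
        unfolding shift mod_mult_self2 using Suc.prems(1) by (auto simp: less_Suc_eq_le)
      then show ?thesis using Suc.prems(2) by metis
    qed
    moreover have "(\<Sum>i<n. \<gamma> (Suc i) * Suc k ^ i) = (\<Sum>i<n. \<delta> (Suc i) * Suc k ^ i)"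
      using Suc.prems(2) \<open>\<gamma> 0 = \<delta> 0\<close> unfolding shift by (metis add_left_cancel mult_left_cancel nat.distinct(1))
    then have "\<forall>i<n. \<gamma> (Suc i) = \<delta> (Suc i)"
      using Suc.prems(1) by (intro Suc.IH) auto
    ultimately show ?case by (auto simp: less_Suc_eq_0_disj)
  qed simp
  have inj: "inj_on w (exps m k)"
  proof (rule inj_onI)
    fix \<gamma> \<delta> assume *: "\<gamma> \<in> exps m k" "\<delta> \<in> exps m k" "w \<gamma> = w \<delta>"
    then have "\<forall>i<m. \<gamma> i = \<delta> i"
      by (intro digits) (auto simp: w_def exps_le)
    then show "\<gamma> = \<delta>" using * by (auto simp: exps_def fun_eq_iff) (metis not_less)
  qed
  define N where "N = Max (w ` exps m k)"
  define e where "e j = (\<Sum>\<gamma>\<in>{\<gamma>\<in>exps m k. w \<gamma> = j}. c \<gamma> - d \<gamma>)" for j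
  have "(\<Sum>j\<le>N. e j * s ^ j) = 0" for s :: real
  proof -
    define x where "x i = (if i < m then s ^ (Suc k ^ i) else 0)" for i
    have x: "x \<in> Rn m" by (simp add: Rn_def x_def)
    have mx: "mon m \<gamma> x = s ^ w \<gamma>" for \<gamma>
      by (simp add: mon_def x_def w_def power_sum mult.commute flip: power_mult)
    have "(\<Sum>j\<le>N. e j * s ^ j) = (\<Sum>j\<le>N. \<Sum>\<gamma>\<in>{\<gamma>\<in>exps m k. w \<gamma> = j}. (c \<gamma> - d \<gamma>) * s ^ w \<gamma>)"
      by (simp add: e_def sum_distrib_right)
    also have "\<dots> = (\<Sum>\<gamma>\<in>exps m k. (c \<gamma> - d \<gamma>) * s ^ w \<gamma>)"
      by (rule sum.group) (auto simp: N_def)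
    also have "\<dots> = 0" using assms(1)[OF x] by (simp add: mx left_diff_distrib sum_subtractf)
    finally show ?thesis .
  qed
  then have "\<forall>j\<le>N. e j = 0" using Transcendental.polyfun_eq_0[of e N] by blast
  moreover have "w \<beta> \<le> N" unfolding N_def using assms(2) by (intro Max_ge) auto
  moreover have "{\<gamma>\<in>exps m k. w \<gamma> = w \<beta>} = {\<beta>}"
    using inj assms(2) by (auto dest: inj_onD)
  ultimately show ?thesis by (auto simp: e_def)
qed

section \<open>Polynomial images of low-dimensional spaces\<close>

text \<open>
  Gaussian elimination: a pivot \<open>g\<^sub>0\<close> of one equation removes that equation and that unknown.
\<close>

lemma underdetermined_system:
  fixes A :: "'b \<Rightarrow> 'g \<Rightarrow> real"
  assumes "finite J" "finite G" "card J < card G"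
  shows "\<exists>l. (\<exists>g\<in>G. l g \<noteq> 0) \<and> (\<forall>j\<in>J. (\<Sum>g\<in>G. l g * A j g) = 0)"
  using assms
proof (induction J arbitrary: G A rule: finite_induct)
  case empty
  then have "G \<noteq> {}" by auto
  then show ?case by (intro exI[of _ "\<lambda>_. 1"]) auto
next
  case (insert j J)
  show ?case
  proof (cases "\<forall>g\<in>G. A j g = 0")
    case True
    have "card J < card G" using insert by simp
    then obtain l where "\<exists>g\<in>G. l g \<noteq> 0" "\<forall>i\<in>J. (\<Sum>g\<in>G. l g * A i g) = 0"
      using insert.IH[OF insert.prems(1)] by blast
    then show ?thesis using True by (intro exI[of _ l]) auto
  next
    case False
    then obtain g0 where g0: "g0 \<in> G" "A j g0 \<noteq> 0" by blast
    define A' where "A' i g = A i g - A i g0 * A j g / A j g0" for i g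
    have "card J < card (G - {g0})" "finite (G - {g0})" using insert g0 by auto
    then obtain l where l: "\<exists>g\<in>G - {g0}. l g \<noteq> 0"
        "\<And>i. i \<in> J \<Longrightarrow> (\<Sum>g\<in>G - {g0}. l g * A' i g) = 0"
      using insert.IH[of "G - {g0}" A'] by blast
    define s where "s = - (\<Sum>g\<in>G - {g0}. l g * A j g) / A j g0"
    have tot: "(\<Sum>g\<in>G. (l(g0 := s)) g * A i g) = s * A i g0 + (\<Sum>g\<in>G - {g0}. l g * A i g)" for i
      using g0(1) insert.prems(1) by (simp add: sum.remove[of G g0])
    have "(\<Sum>g\<in>G. (l(g0 := s)) g * A i g) = 0" if "i \<in> J" for i
    proof -
      have "(\<Sum>g\<in>G - {g0}. l g * A' i g)
          = (\<Sum>g\<in>G - {g0}. l g * A i g) - (A i g0 / A j g0) * (\<Sum>g\<in>G - {g0}. l g * A j g)"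
        by (simp add: A'_def right_diff_distrib sum_subtractf sum_distrib_left mult_ac
            times_divide_eq_right divide_inverse)
      then show ?thesis using l(2)[OF that] tot[of i] by (simp add: s_def)
    qed
    moreover have "(\<Sum>g\<in>G. (l(g0 := s)) g * A j g) = 0"
      using tot[of j] g0(2) by (simp add: s_def)
    moreover have "\<exists>g\<in>G. (l(g0 := s)) g \<noteq> 0" using l(1) by auto
    ultimately show ?thesis by (intro exI[of _ "l(g0 := s)"]) auto
  qed
qed

lemma card_exps_Suc_le: "card (exps (Suc N) D) \<le> (D + N) ^ N"
proof -
  have "card (exps (Suc N) D) = (D + N) choose N"
    by (simp add: card_exps binomial_symmetric[of D "D + N"])
  also have "\<dots> \<le> (D + N) ^ N" by (rule binomial_le_pow) simp
  finally show ?thesis .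
qed

text \<open>
  Forms of degree \<open>2 m (T - 1)\<close> in \<open>N + 1\<close> variables have \<open>O(T\<^sup>N)\<close> coefficients, fewer than the \<open>T\<^sup>m\<close>
  points of a grid once \<open>T\<close> is large. The factor \<open>s\<close> will be the number of maps considered at once.
\<close>

lemma grid_beats_monomials:
  fixes s m N :: nat
  assumes "N < m" "s > 0"
  obtains T where "T > 0" "s * card (exps (Suc N) (2 * m * (T - 1))) < T ^ m"
proof -
  define T where "T = Suc (s * (3 * m) ^ N + N)"
  have "s * card (exps (Suc N) (2 * m * (T - 1))) \<le> s * (2 * m * (T - 1) + N) ^ N"
    by (intro mult_left_mono card_exps_Suc_le) simp
  also have "\<dots> \<le> s * (3 * m * T) ^ N"
  proof (intro mult_left_mono power_mono)
    have "N \<le> m * T" using assms(1) by (simp add: T_def)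
    moreover have "2 * m * (T - 1) \<le> 2 * m * T" by simp
    ultimately show "2 * m * (T - 1) + N \<le> 3 * m * T" by linarith
  qed auto
  also have "\<dots> = s * (3 * m) ^ N * T ^ N" by (simp add: power_mult_distrib)
  also have "\<dots> < T * T ^ N" by (intro mult_strict_right_mono) (auto simp: T_def)
  also have "\<dots> \<le> T ^ m" using assms(1) power_increasing[of "Suc N" m T] by (simp add: T_def)
  finally show ?thesis by (intro that[of T]) (simp_all add: T_def)
qed

text \<open>
  Suppose that each point of a \<open>T\<^sup>M\<close> grid in the box, \<open>M = card I\<close>, has a preimage. A linear dependence
  \<open>l\<close> among the grid points kills all monomials of degree \<open>D\<close> in the preimages, for each map \<open>F s\<close>
  separately. But the indicator of a grid point \<open>h0\<close> is a product of \<open>M (T - 1)\<close> affine functions of the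
  coordinates of \<open>F s t\<close>, hence a polynomial in \<open>t\<close> of degree \<open>D = 2 M (T - 1)\<close>, so \<open>l\<close> vanishes
  at \<open>h0\<close>.
\<close>

lemma quadratic_images_miss_box:
  fixes F :: "'s \<Rightarrow> 'i \<Rightarrow> (nat \<Rightarrow> real) \<Rightarrow> real" and b :: "'i \<Rightarrow> real"
  assumes "finite I" "finite S" "N < card I"
    and F: "\<And>s i. s \<in> S \<Longrightarrow> i \<in> I \<Longrightarrow> hform N 2 (F s i)"
    and "\<eta> > 0"
  shows "\<exists>g. (\<forall>i\<in>I. \<bar>g i\<bar> \<le> \<eta>) \<and> (\<forall>s\<in>S. \<forall>t\<in>Rn N. \<exists>i\<in>I. F s i t \<noteq> b i + g i)"
proof (cases "S = {}")
  case True
  then show ?thesis using \<open>\<eta> > 0\<close> by (intro exI[of _ "\<lambda>_. 0"]) auto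
next
  case False
  show ?thesis
  proof (rule ccontr)
    assume no: "\<not> ?thesis"
    have "card S > 0" using False \<open>finite S\<close> by (simp add: card_gt_0_iff)
    then obtain T where T: "T > 0"
        "card S * card (exps (Suc N) (2 * card I * (T - 1))) < T ^ card I"
      using grid_beats_monomials[OF \<open>N < card I\<close>] by metis
    define D where "D = 2 * card I * (T - 1)"
    define H where "H = (\<Pi>\<^sub>E i\<in>I. {..<T})"
    define J where "J = S \<times> exps (Suc N) D"
    have H: "finite H" "card H = T ^ card I"
      using \<open>finite I\<close> by (auto simp: H_def card_PiE finite_PiE)
    have J: "finite J" "card J = card S * card (exps (Suc N) D)"
      using \<open>finite S\<close> by (auto simp: J_def card_cartesian_product)
    have "\<forall>h\<in>H. \<exists>s t. s \<in> S \<and> t \<in> Rn N \<and> (\<forall>i\<in>I. F s i t = b i + \<eta> * real (h i) / real T)"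
    proof
      fix h assume h: "h \<in> H"
      have "\<forall>i\<in>I. \<bar>\<eta> * real (h i) / real T\<bar> \<le> \<eta>"
      proof
        fix i assume "i \<in> I"
        then have "h i < T" using h by (auto simp: H_def)
        then have "real (h i) / real T \<le> 1" by simp
        then have "\<eta> * (real (h i) / real T) \<le> \<eta> * 1"
          using \<open>\<eta> > 0\<close> by (intro mult_left_mono) auto
        then show "\<bar>\<eta> * real (h i) / real T\<bar> \<le> \<eta>" using \<open>\<eta> > 0\<close> by simp
      qed
      then show "\<exists>s t. s \<in> S \<and> t \<in> Rn N \<and> (\<forall>i\<in>I. F s i t = b i + \<eta> * real (h i) / real T)"
        using no by (auto dest!: spec[of _ "\<lambda>i. \<eta> * real (h i) / real T"] simp: add_divide_distrib)
    qed
    then obtain \<sigma> \<tau> where st: "\<And>h. h \<in> H \<Longrightarrow> \<sigma> h \<in> S" "\<And>h. h \<in> H \<Longrightarrow> \<tau> h \<in> Rn N"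
        "\<And>h i. h \<in> H \<Longrightarrow> i \<in> I \<Longrightarrow> F (\<sigma> h) i (\<tau> h) = b i + \<eta> * real (h i) / real T"
      by metis
    \<comment> \<open>The extra coordinate 1 homogenizes: affine functions of the preimages become forms.\<close>
    define x where "x h = (\<tau> h)(N := 1)" for h
    have x: "x h \<in> Rn (Suc N)" if "h \<in> H" for h
      using st(2)[OF that] by (auto simp: Rn_def x_def)
    have xN: "(\<lambda>i. if i < N then x h i else 0) = \<tau> h" "x h N = 1" if "h \<in> H" for h
      using st(2)[OF that] by (auto simp: Rn_def x_def fun_eq_iff)
    have "card J < card H" using T(2) H(2) J(2) by (simp add: D_def)
    from underdetermined_system[OF J(1) H(1) this,
        of "\<lambda>j h. if \<sigma> h = fst j then mon (Suc N) (snd j) (x h) else 0"]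
    obtain l where l: "\<exists>h\<in>H. l h \<noteq> 0" and
      sys: "\<forall>j\<in>J. (\<Sum>h\<in>H. l h * (if \<sigma> h = fst j then mon (Suc N) (snd j) (x h) else 0)) = 0"
      by blast
    obtain h0 where h0: "h0 \<in> H" "l h0 \<noteq> 0" using l by blast
    \<comment> \<open>The dependence annihilates every form in the preimages, for each map separately.\<close>
    have kill: "(\<Sum>h\<in>H. l h * (if \<sigma> h = s then f (x h) else 0)) = 0"
      if sS: "s \<in> S" and hf: "hform (Suc N) D f" for s f
    proof -
      obtain c where c: "\<And>x. x \<in> Rn (Suc N) \<Longrightarrow> f x = (\<Sum>\<beta>\<in>exps (Suc N) D. c \<beta> * mon (Suc N) \<beta> x)"
        using hf unfolding hform_def by blast
      have "(\<Sum>h\<in>H. l h * (if \<sigma> h = s then f (x h) else 0)) =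
          (\<Sum>h\<in>H. \<Sum>\<beta>\<in>exps (Suc N) D. c \<beta> * (l h * (if \<sigma> h = s then mon (Suc N) \<beta> (x h) else 0)))"
        by (intro sum.cong) (auto simp: c x sum_distrib_left mult_ac)
      also have "\<dots> = (\<Sum>\<beta>\<in>exps (Suc N) D. c \<beta> *
          (\<Sum>h\<in>H. l h * (if \<sigma> h = s then mon (Suc N) \<beta> (x h) else 0)))"
        by (subst sum.swap) (simp only: sum_distrib_left)
      also have "\<dots> = 0"
        using bspec[OF sys, of "(s, _)"] sS by (intro sum.neutral) (simp add: J_def cong: if_cong)
      finally show ?thesis .
    qed
    \<comment> \<open>The indicator of h0, up to a non-zero factor: coordinate i of a grid point is h i after
      rescaling, and one factor vanishes for each value other than h0 i.\<close>
    define P where "P s z = (\<Prod>i\<in>I. \<Prod>r\<in>{..<T} - {h0 i}.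
        (real T / \<eta>) * (F s i (\<lambda>j. if j < N then z j else 0) - b i * z N ^ 2) - real r * z N ^ 2)"
      for s and z :: "nat \<Rightarrow> real"
    have P: "hform (Suc N) D (P s)" if "s \<in> S" for s
    proof -
      have q: "hform (Suc N) 2 (\<lambda>z. z N ^ 2)"
        using hform_power[OF hform_coord[of N "Suc N"], of 2] by simp
      have "hform (Suc N) (\<Sum>i\<in>I. \<Sum>r\<in>{..<T} - {h0 i}. 2) (P s)"
        unfolding P_def
        by (intro hform_prod hform_diff hform_cmult hform_extend F that q) auto
      moreover have "(\<Sum>i\<in>I. \<Sum>r\<in>{..<T} - {h0 i}. 2) = D"
      proof -
        have "card ({..<T} - {h0 i}) = T - 1" if "i \<in> I" for i
        proof -
          have "h0 i \<in> {..<T}" using that h0(1) unfolding H_def by (rule PiE_mem[rotated])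
          then show ?thesis by (simp add: card_Diff_singleton)
        qed
        then show ?thesis by (simp add: D_def mult_ac)
      qed
      ultimately show ?thesis by simp
    qed
    have Pval: "P (\<sigma> h) (x h) = (\<Prod>i\<in>I. \<Prod>r\<in>{..<T} - {h0 i}. real (h i) - real r)" if "h \<in> H" for h
    proof -
      have "(real T / \<eta>) * (F (\<sigma> h) i (\<tau> h) - b i) = real (h i)" if "i \<in> I" for i
        using st(3)[OF \<open>h \<in> H\<close> that] \<open>\<eta> > 0\<close> T(1) by simp
      then show ?thesis by (simp add: P_def xN[OF that])
    qed
    have P0: "P (\<sigma> h) (x h) = 0" if h: "h \<in> H" and ne: "h \<noteq> h0" for h
    proof -
      obtain i where i: "i \<in> I" "h i \<noteq> h0 i"
        using PiE_ext[OF h[unfolded H_def] h0(1)[unfolded H_def]] ne by blast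
      then have "h i \<in> {..<T} - {h0 i}" using h by (auto simp: H_def)
      then have "(\<Prod>r\<in>{..<T} - {h0 i}. real (h i) - real r) = 0" by (intro prod_zero) auto
      then show ?thesis
        unfolding Pval[OF h] using i(1) \<open>finite I\<close> by (intro prod_zero) auto
    qed
    have "0 = (\<Sum>s\<in>S. \<Sum>h\<in>H. l h * (if \<sigma> h = s then P s (x h) else 0))"
      using kill P by simp
    also have "\<dots> = (\<Sum>h\<in>H. l h * P (\<sigma> h) (x h))"
      by (subst sum.swap) (use st(1) \<open>finite S\<close> in \<open>simp flip: sum_distrib_left\<close>)
    also have "\<dots> = l h0 * P (\<sigma> h0) (x h0)"
      using h0(1) H(1) P0 by (subst sum.remove[of H h0]) auto
    finally have "P (\<sigma> h0) (x h0) = 0" using h0(2) by simp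
    then show False using \<open>finite I\<close> by (simp add: Pval[OF h0(1)])
  qed
qed

section \<open>Forms that are not differences of two products\<close>

text \<open>
  The coefficient of a product of two forms, as a function of the coefficients of the factors; it is
  bilinear, which is what the degree 2 in the dimension count expresses.
\<close>

definition conv_coeff ::
    "nat \<Rightarrow> nat \<Rightarrow> nat \<Rightarrow> ((nat \<Rightarrow> nat) \<Rightarrow> real) \<Rightarrow> ((nat \<Rightarrow> nat) \<Rightarrow> real) \<Rightarrow> (nat \<Rightarrow> nat) \<Rightarrow> real" where
  "conv_coeff m k l c d \<alpha> =
     (\<Sum>\<beta>\<in>exps m k. \<Sum>\<gamma>\<in>exps m l. if (\<lambda>i. \<beta> i + \<gamma> i) = \<alpha> then c \<beta> * d \<gamma> else 0)"

lemma mult_eq_conv_coeff: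
  "(\<Sum>\<beta>\<in>exps m k. c \<beta> * mon m \<beta> x) * (\<Sum>\<gamma>\<in>exps m l. d \<gamma> * mon m \<gamma> x)
    = (\<Sum>\<alpha>\<in>exps m (k + l). conv_coeff m k l c d \<alpha> * mon m \<alpha> x)"
proof -
  have "(\<Sum>\<alpha>\<in>exps m (k + l). conv_coeff m k l c d \<alpha> * mon m \<alpha> x)
      = (\<Sum>\<alpha>\<in>exps m (k + l). \<Sum>\<beta>\<in>exps m k. \<Sum>\<gamma>\<in>exps m l.
          if (\<lambda>i. \<beta> i + \<gamma> i) = \<alpha> then c \<beta> * d \<gamma> * mon m \<alpha> x else 0)"
    unfolding conv_coeff_def sum_distrib_right by (intro sum.cong) auto
  also have "\<dots> = (\<Sum>\<beta>\<in>exps m k. \<Sum>\<alpha>\<in>exps m (k + l). \<Sum>\<gamma>\<in>exps m l.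
          if (\<lambda>i. \<beta> i + \<gamma> i) = \<alpha> then c \<beta> * d \<gamma> * mon m \<alpha> x else 0)"
    by (rule sum.swap)
  also have "\<dots> = (\<Sum>\<beta>\<in>exps m k. \<Sum>\<gamma>\<in>exps m l. \<Sum>\<alpha>\<in>exps m (k + l).
          if (\<lambda>i. \<beta> i + \<gamma> i) = \<alpha> then c \<beta> * d \<gamma> * mon m \<alpha> x else 0)"
    by (rule sum.cong[OF refl]) (rule sum.swap)
  also have "\<dots> = (\<Sum>\<beta>\<in>exps m k. \<Sum>\<gamma>\<in>exps m l. c \<beta> * d \<gamma> * mon m (\<lambda>i. \<beta> i + \<gamma> i) x)"
    by (intro sum.cong refl) (simp add: exps_add)
  also have "\<dots> = (\<Sum>\<beta>\<in>exps m k. c \<beta> * mon m \<beta> x) * (\<Sum>\<gamma>\<in>exps m l. d \<gamma> * mon m \<gamma> x)"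
    by (simp add: sum_product mon_add mult_ac)
  finally show ?thesis ..
qed

lemma hform_conv_coeff:
  assumes "\<And>\<beta>. \<beta> \<in> exps m k \<Longrightarrow> r \<beta> < N" "\<And>\<gamma>. \<gamma> \<in> exps m l \<Longrightarrow> s \<gamma> < N"
  shows "hform N 2 (\<lambda>t. conv_coeff m k l (\<lambda>\<beta>. t (r \<beta>)) (\<lambda>\<gamma>. t (s \<gamma>)) \<alpha>)"
  unfolding conv_coeff_def
proof (intro hform_sum)
  fix \<beta> \<gamma> assume "\<beta> \<in> exps m k" "\<gamma> \<in> exps m l"
  then have "hform N (1 + 1) (\<lambda>t. t (r \<beta>) * t (s \<gamma>))"
    using assms by (intro hform_mult hform_coord) auto
  then show "hform N 2 (\<lambda>t. if (\<lambda>i. \<beta> i + \<gamma> i) = \<alpha> then t (r \<beta>) * t (s \<gamma>) else 0)"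
    by (cases "(\<lambda>i. \<beta> i + \<gamma> i) = \<alpha>") (simp_all add: hform_zero numeral_2_eq_2)
qed

lemma conv_coeff_cong:
  assumes "\<And>\<beta>. \<beta> \<in> exps m k \<Longrightarrow> c \<beta> = c' \<beta>" "\<And>\<gamma>. \<gamma> \<in> exps m l \<Longrightarrow> d \<gamma> = d' \<gamma>"
  shows "conv_coeff m k l c d \<alpha> = conv_coeff m k l c' d' \<alpha>"
  unfolding conv_coeff_def using assms by (intro sum.cong) auto

text \<open>
  For each \<open>k\<close> the coefficients of \<open>a b - f h\<close> are quadratic forms in the coefficients of \<open>a, b, f, h\<close>, whose
  number is smaller than the number of coefficients of a form of degree \<open>2 y\<close>. There are finitely many \<open>k\<close>,
  so one perturbation avoids all of these images.
\<close>

lemma generic_perturbation_not_product: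
  assumes few: "\<And>k. 0 < k \<Longrightarrow> 2 * k \<le> y \<Longrightarrow>
      2 * card (exps m y) + card (exps m (y + k)) + card (exps m (y - k)) < card (exps m (2 * y))"
    and "y \<ge> 2" and q0: "hform m (2 * y) q0" and "\<eta> > 0"
  obtains g where "\<And>\<alpha>. \<alpha> \<in> exps m (2 * y) \<Longrightarrow> \<bar>g \<alpha>\<bar> \<le> \<eta>"
    "\<And>k a b f h. 0 < k \<Longrightarrow> 2 * k \<le> y \<Longrightarrow> hform m y a \<Longrightarrow> hform m y b \<Longrightarrow>
      hform m (y + k) f \<Longrightarrow> hform m (y - k) h \<Longrightarrow>
      \<not> (\<forall>x\<in>Rn m. q0 x + (\<Sum>\<alpha>\<in>exps m (2 * y). g \<alpha> * mon m \<alpha> x) = a x * b x - f x * h x)"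
proof -
  define N where "N = card (exps m (2 * y)) - 1"
  have N: "N < card (exps m (2 * y))" using few[of 1] \<open>y \<ge> 2\<close> by (simp add: N_def)
  obtain c0 where c0: "\<And>x. x \<in> Rn m \<Longrightarrow> q0 x = (\<Sum>\<alpha>\<in>exps m (2 * y). c0 \<alpha> * mon m \<alpha> x)"
    using q0 unfolding hform_def by blast
  define S where "S = {k. 0 < k \<and> 2 * k \<le> y}"
  have "finite S" by (rule finite_subset[of _ "{..y}"]) (auto simp: S_def)
  \<comment> \<open>The four families of coefficients are indexed by pairs \<open>(j, \<beta>)\<close> with \<open>j\<close> = 0, 1, 2, 3 for
    \<open>a\<close>, \<open>b\<close>, \<open>f\<close>, \<open>h\<close>; the injection \<open>e\<close> packs them into one vector of parameters.\<close>
  define deg where "deg k j = (if j = (2::nat) then y + k else if j = 3 then y - k else y)" for k j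
  define Z where "Z k = (SIGMA j:{..<4}. exps m (deg k j))" for k
  have "\<exists>e. inj_on e (Z k) \<and> e ` Z k \<subseteq> {..<N}" if "k \<in> S" for k
  proof -
    have "card (Z k) = (\<Sum>j<4. card (exps m (deg k j)))" by (simp add: Z_def)
    also have "\<dots> = 2 * card (exps m y) + card (exps m (y + k)) + card (exps m (y - k))"
      by (simp add: deg_def eval_nat_numeral)
    also have "\<dots> \<le> N" using few[of k] that by (simp add: S_def N_def)
    finally have "card (Z k) \<le> card {..<N}" by simp
    moreover have "finite (Z k)" by (simp add: Z_def)
    ultimately show ?thesis using card_le_inj[of "Z k" "{..<N}"] by blast
  qed
  then have "\<forall>k\<in>S. \<exists>e. inj_on e (Z k) \<and> e ` Z k \<subseteq> {..<N}" by blast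
  from bchoice[OF this] obtain e where
    e: "\<And>k. k \<in> S \<Longrightarrow> inj_on (e k) (Z k)" "\<And>k. k \<in> S \<Longrightarrow> e k ` Z k \<subseteq> {..<N}"
    by blast
  define F where "F k \<alpha> t =
      conv_coeff m y y (\<lambda>\<beta>. t (e k (0, \<beta>))) (\<lambda>\<gamma>. t (e k (1, \<gamma>))) \<alpha>
      - conv_coeff m (y + k) (y - k) (\<lambda>\<beta>. t (e k (2, \<beta>))) (\<lambda>\<gamma>. t (e k (3, \<gamma>))) \<alpha>"
    for k \<alpha> and t :: "nat \<Rightarrow> real"
  have "hform N 2 (F k \<alpha>)" if "k \<in> S" for k \<alpha>
  proof -
    have "e k (j, \<beta>) < N" if "j < 4" "\<beta> \<in> exps m (deg k j)" for j \<beta>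
      using e(2)[OF \<open>k \<in> S\<close>] that by (auto simp: Z_def)
    then show ?thesis
      unfolding F_def by (intro hform_diff hform_conv_coeff) (auto simp: deg_def)
  qed
  then obtain g where g: "\<forall>\<alpha>\<in>exps m (2 * y). \<bar>g \<alpha>\<bar> \<le> \<eta>"
    and miss: "\<forall>k\<in>S. \<forall>t\<in>Rn N. \<exists>\<alpha>\<in>exps m (2 * y). F k \<alpha> t \<noteq> c0 \<alpha> + g \<alpha>"
    using quadratic_images_miss_box[OF finite_exps \<open>finite S\<close> N, of F \<eta> c0] \<open>\<eta> > 0\<close> by blast
  show ?thesis
  proof (rule that[of g])
    show "\<bar>g \<alpha>\<bar> \<le> \<eta>" if "\<alpha> \<in> exps m (2 * y)" for \<alpha> using g that by blast
    fix k a b f h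
    assume k: "0 < k" "2 * k \<le> y" and ab: "hform m y a" "hform m y b"
      and fh: "hform m (y + k) f" "hform m (y - k) h"
    show "\<not> (\<forall>x\<in>Rn m. q0 x + (\<Sum>\<alpha>\<in>exps m (2 * y). g \<alpha> * mon m \<alpha> x) = a x * b x - f x * h x)"
    proof
      assume eq: "\<forall>x\<in>Rn m. q0 x + (\<Sum>\<alpha>\<in>exps m (2 * y). g \<alpha> * mon m \<alpha> x) = a x * b x - f x * h x"
      have kS: "k \<in> S" using k by (simp add: S_def)
      obtain ca where ca: "\<And>x. x \<in> Rn m \<Longrightarrow> a x = (\<Sum>\<beta>\<in>exps m y. ca \<beta> * mon m \<beta> x)"
        using ab(1) unfolding hform_def by blast
      obtain cb where cb: "\<And>x. x \<in> Rn m \<Longrightarrow> b x = (\<Sum>\<beta>\<in>exps m y. cb \<beta> * mon m \<beta> x)"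
        using ab(2) unfolding hform_def by blast
      obtain cf where cf: "\<And>x. x \<in> Rn m \<Longrightarrow> f x = (\<Sum>\<beta>\<in>exps m (y + k). cf \<beta> * mon m \<beta> x)"
        using fh(1) unfolding hform_def by blast
      obtain ch where ch: "\<And>x. x \<in> Rn m \<Longrightarrow> h x = (\<Sum>\<beta>\<in>exps m (y - k). ch \<beta> * mon m \<beta> x)"
        using fh(2) unfolding hform_def by blast
      define cc where "cc z = (if fst z = (0::nat) then ca else if fst z = 1 then cb
          else if fst z = 2 then cf else ch) (snd z)" for z
      define t where "t i = (if i \<in> e k ` Z k then cc (inv_into (Z k) (e k) i) else 0)" for i
      have "t \<in> Rn N" using e(2)[OF kS] by (auto simp: Rn_def t_def)
      then obtain \<alpha> where \<alpha>: "\<alpha> \<in> exps m (2 * y)" "F k \<alpha> t \<noteq> c0 \<alpha> + g \<alpha>"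
        using miss kS by blast
      have te: "t (e k (j, \<beta>)) = cc (j, \<beta>)" if "j < 4" "\<beta> \<in> exps m (deg k j)" for j \<beta>
        using that e(1)[OF kS] by (simp add: t_def Z_def)
      have F: "F k \<alpha>' t = conv_coeff m y y ca cb \<alpha>' - conv_coeff m (y + k) (y - k) cf ch \<alpha>'" for \<alpha>'
        unfolding F_def
        by (intro arg_cong2[of _ _ _ _ "(-)"] conv_coeff_cong) (simp_all add: te deg_def cc_def)
      have deg2: "y + y = 2 * y" "(y + k) + (y - k) = 2 * y" using k by simp_all
      have "c0 \<alpha> + g \<alpha> = F k \<alpha> t"
      proof (rule hform_coeffs_unique[OF _ \<alpha>(1)])
        fix x assume x: "x \<in> Rn m"
        have "(\<Sum>\<alpha>\<in>exps m (2 * y). (c0 \<alpha> + g \<alpha>) * mon m \<alpha> x) = a x * b x - f x * h x"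
          using eq x by (simp add: c0 distrib_right sum.distrib)
        also have "\<dots> = (\<Sum>\<alpha>\<in>exps m (2 * y). F k \<alpha> t * mon m \<alpha> x)"
          unfolding ca[OF x] cb[OF x] cf[OF x] ch[OF x] mult_eq_conv_coeff deg2 F left_diff_distrib
            sum_subtractf ..
        finally show "(\<Sum>\<alpha>\<in>exps m (2 * y). (c0 \<alpha> + g \<alpha>) * mon m \<alpha> x)
          = (\<Sum>\<alpha>\<in>exps m (2 * y). F k \<alpha> t * mon m \<alpha> x)" .
      qed
      then show False using \<alpha>(2) by simp
    qed
  qed
qed

section \<open>Counting coefficients\<close>

lemma card_exps_Suc: "Suc m * card (exps (Suc (Suc m)) j) = (j + Suc m) * card (exps (Suc m) j)"
proof -
  have "card (exps (Suc (Suc m)) j) = (j + Suc m) choose Suc m"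
    by (simp add: card_exps binomial_symmetric[of j])
  moreover have "card (exps (Suc m) j) = (j + m) choose m"
    by (simp add: card_exps binomial_symmetric[of j])
  ultimately show ?thesis using Suc_times_binomial_eq[of "j + m" m] by (simp add: mult.commute)
qed

lemma card_exps_1: "card (exps (Suc 0) j) = 1"
  by (simp add: card_exps)

lemma card_exps_4: "6 * card (exps 4 j) = (j + 1) * (j + 2) * (j + 3)"
  and card_exps_5: "24 * card (exps 5 j) = (j + 1) * (j + 2) * (j + 3) * (j + 4)"
  and card_exps_6: "120 * card (exps 6 j) = (j + 1) * (j + 2) * (j + 3) * (j + 4) * (j + 5)"
proof -
  define E where "E m = card (exps m j)" for m
  have e: "E 2 = j + 1" "2 * E 3 = (j + 2) * E 2" "3 * E 4 = (j + 3) * E 3" "4 * E 5 = (j + 4) * E 4"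
    "5 * E 6 = (j + 5) * E 5"
    using card_exps_Suc[of 0 j] card_exps_Suc[of 1 j] card_exps_Suc[of 2 j] card_exps_Suc[of 3 j]
      card_exps_Suc[of 4 j] card_exps_1[of j]
    by (simp_all add: E_def eval_nat_numeral)
  have 4: "6 * E 4 = (j + 1) * (j + 2) * (j + 3)"
  proof -
    have "6 * E 4 = (j + 3) * (2 * E 3)" using e(3) by simp
    then show ?thesis unfolding e(1,2) by (simp only: mult_ac)
  qed
  have 5: "24 * E 5 = (j + 1) * (j + 2) * (j + 3) * (j + 4)"
  proof -
    have "24 * E 5 = (j + 4) * (6 * E 4)" using e(4) by simp
    then show ?thesis unfolding 4 by (simp only: mult_ac)
  qed
  have 6: "120 * E 6 = (j + 1) * (j + 2) * (j + 3) * (j + 4) * (j + 5)"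
  proof -
    have "120 * E 6 = (j + 5) * (24 * E 5)" using e(5) by simp
    then show ?thesis unfolding 5 by (simp only: mult_ac)
  qed
  show "6 * card (exps 4 j) = (j + 1) * (j + 2) * (j + 3)"
    "24 * card (exps 5 j) = (j + 1) * (j + 2) * (j + 3) * (j + 4)"
    "120 * card (exps 6 j) = (j + 1) * (j + 2) * (j + 3) * (j + 4) * (j + 5)"
    using 4 5 6 by (simp_all only: E_def)
qed

text \<open>
  With \<open>y = 2 k + s\<close> the difference of both sides is a polynomial in \<open>k\<close> and \<open>s\<close>. Its coefficients become positive
  after a shift of the variables to the allowed range, which is why small \<open>k\<close> is treated separately for
  \<open>m = 4\<close> and \<open>m = 5\<close>. There is little slack: for \<open>m = 4\<close>, \<open>y = 4\<close>, \<open>k = 2\<close> the two sides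
  are 164 and 165, while they are 85 and 84 for \<open>m = 4\<close>, \<open>y = 3\<close>, \<open>k = 1\<close>, and both are 70 for \<open>m = 5\<close>, \<open>y = 2\<close>, \<open>k = 1\<close>.
\<close>

lemma card_exps_product_lt:
  assumes "(m = 4 \<and> y \<ge> 4) \<or> (m = 5 \<and> y \<ge> 3) \<or> (m = 6 \<and> y \<ge> 2)" and k: "0 < k" "2 * k \<le> y"
  shows "2 * card (exps m y) + card (exps m (y + k)) + card (exps m (y - k)) < card (exps m (2 * y))"
proof -
  define s where "s = y - 2 * k"
  have y: "y = 2 * k + s" using k(2) by (simp add: s_def)
  have yk: "y - k = k + s" using y by simp
  consider (4) "m = 4" "y \<ge> 4" | (5) "m = 5" "y \<ge> 3" | (6) "m = 6" "y \<ge> 2"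
    using assms(1) by blast
  then show ?thesis
  proof cases
    case 4
    have "2 * (6 * card (exps 4 y)) + 6 * card (exps 4 (y + k)) + 6 * card (exps 4 (y - k))
        < 6 * card (exps 4 (2 * y))"
    proof (cases "k = 1")
      case True
      then have "s = Suc (Suc (s - 2))" using 4 y by simp
      then obtain r where "s = Suc (Suc r)" by blast
      then show ?thesis unfolding card_exps_4 yk y True by (simp add: algebra_simps)
    next
      case False
      then have "k = Suc (Suc (k - 2))" using k by simp
      then obtain l where "k = Suc (Suc l)" by blast
      then show ?thesis unfolding card_exps_4 yk y by (simp add: algebra_simps)
    qed
    then show ?thesis using 4 by simp
  next
    case 5
    have "2 * (24 * card (exps 5 y)) + 24 * card (exps 5 (y + k)) + 24 * card (exps 5 (y - k))
        < 24 * card (exps 5 (2 * y))"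
    proof (cases "k = 1")
      case True
      then have "s = Suc (s - 1)" using 5 y by simp
      then obtain r where "s = Suc r" by blast
      then show ?thesis unfolding card_exps_5 yk y True by (simp add: algebra_simps)
    next
      case False
      then have "k = Suc (Suc (k - 2))" using k by simp
      then obtain l where "k = Suc (Suc l)" by blast
      then show ?thesis unfolding card_exps_5 yk y by (simp add: algebra_simps)
    qed
    then show ?thesis using 5 by simp
  next
    case 6
    obtain l where "k = Suc l" using k(1) by (cases k) auto
    then have "2 * (120 * card (exps 6 y)) + 120 * card (exps 6 (y + k)) + 120 * card (exps 6 (y - k))
        < 120 * card (exps 6 (2 * y))"
      unfolding card_exps_6 yk y by (simp add: algebra_simps)
    then show ?thesis using 6 by simp
  qed
qed

section \<open>Wronskians of hyperbolic forms\<close>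

definition sym_bilinear :: "((nat \<Rightarrow> real) \<Rightarrow> (nat \<Rightarrow> real) \<Rightarrow> real) \<Rightarrow> bool" where
  "sym_bilinear B \<longleftrightarrow> (\<forall>x y. B x y = B y x) \<and>
     (\<forall>s t x y z. B (\<lambda>i. s * x i + t * y i) z = s * B x z + t * B y z)"

lemma sym_bilinear_line:
  assumes "sym_bilinear B"
  shows "B (\<lambda>i. x i + t * y i) z = B x z + t * B y z"
    and "B z (\<lambda>i. x i + t * y i) = B z x + t * B z y"
proof -
  have "B (\<lambda>i. 1 * x i + t * y i) z = 1 * B x z + t * B y z"
    using assms unfolding sym_bilinear_def by blast
  then show 1: "B (\<lambda>i. x i + t * y i) z = B x z + t * B y z" by simp
  have "B a b = B b a" for a b using assms unfolding sym_bilinear_def by blast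
  then show "B z (\<lambda>i. x i + t * y i) = B z x + t * B z y" using 1 by metis
qed

lemma sym_bilinear_scale:
  assumes "sym_bilinear B"
  shows "B (\<lambda>i. t * y i) z = t * B y z" "B z (\<lambda>i. t * y i) = t * B z y"
proof -
  have "B (\<lambda>i. 0 * y i + t * y i) z = 0 * B y z + t * B y z"
    using assms unfolding sym_bilinear_def by blast
  then show 1: "B (\<lambda>i. t * y i) z = t * B y z" by simp
  have "B a b = B b a" for a b using assms unfolding sym_bilinear_def by blast
  then show "B z (\<lambda>i. t * y i) = t * B z y" using 1 by metis
qed

text \<open>
  A monomial of degree two is a product of two variables, possibly equal.
\<close>

lemma exps_2_cases:
  assumes "\<beta> \<in> exps n 2"
  shows "\<exists>i j. i < n \<and> j < n \<and> \<beta> = (\<lambda>k. (if k = i then 1 else 0) + (if k = j then 1 else 0))"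
proof -
  have pick: "\<exists>i<n. \<gamma> i > 0 \<and> \<gamma>(i := \<gamma> i - 1) \<in> exps n l" if "\<gamma> \<in> exps n (Suc l)" for \<gamma> l
  proof -
    have "(\<Sum>i<n. \<gamma> i) \<noteq> 0" using that by (simp add: exps_def)
    then obtain i where i: "i < n" "\<gamma> i > 0" by (metis gr0I lessThan_iff sum.neutral)
    moreover have "(\<Sum>j<n. (\<gamma>(i := \<gamma> i - 1)) j) = l"
      using that i by (simp add: exps_def sum.remove[of "{..<n}" i])
    ultimately show ?thesis using that by (auto simp: exps_def)
  qed
  obtain i where i: "i < n" "\<beta> i > 0" "\<beta>(i := \<beta> i - 1) \<in> exps n 1"
    using pick[of \<beta> 1] assms by (auto simp: numeral_2_eq_2)
  define \<gamma> where "\<gamma> = \<beta>(i := \<beta> i - 1)"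
  obtain j where j: "j < n" "\<gamma> j > 0" "\<gamma>(j := \<gamma> j - 1) \<in> exps n 0"
    using pick[of \<gamma> 0] i by (auto simp: \<gamma>_def)
  have z: "(\<gamma>(j := \<gamma> j - 1)) k = 0" for k
    using exps_le[OF j(3), of k] by simp
  have "\<gamma> k = (if k = j then 1 else 0)" for k
    using j(2) z[of k] by (auto split: if_splits)
  moreover have "\<beta> k = (if k = i then 1 else 0) + \<gamma> k" for k
    using i(2) by (simp add: \<gamma>_def)
  ultimately show ?thesis using i(1) j(1) by (intro exI[of _ i] exI[of _ j]) auto
qed

text \<open>
  The complex expansion is part of the statement because hyperbolicity is a condition on complex roots.
\<close>

lemma quadratic_form_polarization:
  assumes "p \<in> forms n 2"
  obtains B where "sym_bilinear B" "\<And>x. peval p x = B x x"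
    "\<And>e x (t::complex). peval p (\<lambda>i. t * of_real (e i) - of_real (x i))
        = of_real (B e e) * t\<^sup>2 - 2 * of_real (B e x) * t + of_real (B x x)"
proof -
  have "\<exists>f. \<forall>\<beta>\<in>exps n 2. fst (f \<beta>) < n \<and> snd (f \<beta>) < n \<and>
      \<beta> = (\<lambda>k. (if k = fst (f \<beta>) then 1 else 0) + (if k = snd (f \<beta>) then 1 else 0))"
    by (rule bchoice) (use exps_2_cases in force)
  then obtain f where f: "\<forall>\<beta>\<in>exps n 2. fst (f \<beta>) < n \<and> snd (f \<beta>) < n \<and>
      \<beta> = (\<lambda>k. (if k = fst (f \<beta>) then 1 else 0) + (if k = snd (f \<beta>) then 1 else 0))"
    by blast
  define r where "r \<beta> = fst (f \<beta>)" for \<beta>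
  define s where "s \<beta> = snd (f \<beta>)" for \<beta>
  have rs: "r \<beta> < n" "s \<beta> < n"
      "\<beta> = (\<lambda>k. (if k = r \<beta> then 1 else 0) + (if k = s \<beta> then 1 else 0))" if "\<beta> \<in> exps n 2" for \<beta>
    using bspec[OF f that] by (simp_all add: r_def s_def)
  have mon2: "mon n \<beta> x = x (r \<beta>) * x (s \<beta>)" if "\<beta> \<in> exps n 2"
    for \<beta> and x :: "nat \<Rightarrow> 'a::{real_algebra_1,comm_ring_1}"
  proof -
    have "mon n \<beta> x = mon n (\<lambda>k. (if k = r \<beta> then 1 else 0) + (if k = s \<beta> then 1 else 0)) x"
      using rs(3)[OF that] by (rule arg_cong)
    also have "\<dots> = x (r \<beta>) * x (s \<beta>)"
      using rs(1,2)[OF that] by (simp only: mon_add mon_unit)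
    finally show ?thesis .
  qed
  define c where "c \<beta> = Poly_Mapping.lookup p (Abs_poly_mapping \<beta>)" for \<beta>
  define B where "B x y = (\<Sum>\<beta>\<in>exps n 2. c \<beta> * ((x (r \<beta>) * y (s \<beta>) + x (s \<beta>) * y (r \<beta>)) / 2))"
    for x y :: "nat \<Rightarrow> real"
  show ?thesis
  proof (rule that[of B])
    show "sym_bilinear B"
      unfolding sym_bilinear_def B_def
      by (auto simp: sum_distrib_left algebra_simps add_divide_distrib simp flip: sum.distrib intro!: sum.cong)
    show "peval p x = B x x" for x
      unfolding peval_forms[OF assms] B_def c_def by (intro sum.cong) (auto simp: mon2 mult_ac)
    show "peval p (\<lambda>i. t * of_real (e i) - of_real (x i))
        = of_real (B e e) * t\<^sup>2 - 2 * of_real (B e x) * t + of_real (B x x)" for e x and t :: complex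
      unfolding peval_forms[OF assms] B_def c_def of_real_sum sum_distrib_left sum_distrib_right
        sum_subtractf[symmetric] sum.distrib[symmetric]
      by (intro sum.cong) (auto simp: mon2 power2_eq_square field_simps)
  qed
qed

text \<open>
  The determinant of a positive semidefinite \<open>3 \<times> 3\<close> matrix. If the leading \<open>2 \<times> 2\<close> minor \<open>D\<close> is
  positive, the quadratic form at the last column of the adjugate is \<open>D\<close> times the determinant. If \<open>D = 0\<close>, the
  form has kernel vectors in the first two coordinates; orthogonality of these to everything makes the determinant
  vanish.
\<close>

lemma gram_det_nonneg:
  fixes uu vv zz uv uz vz :: real
  assumes psd: "\<And>a b c. a\<^sup>2 * uu + b\<^sup>2 * vv + c\<^sup>2 * zz + 2 * a * b * uv + 2 * a * c * uz + 2 * b * c * vz \<ge> 0"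
  shows "uu * vv * zz + 2 * uv * uz * vz - uu * vz\<^sup>2 - vv * uz\<^sup>2 - zz * uv\<^sup>2 \<ge> 0"
proof -
  define D where "D = uu * vv - uv\<^sup>2"
  let ?det = "uu * vv * zz + 2 * uv * uz * vz - uu * vz\<^sup>2 - vv * uz\<^sup>2 - zz * uv\<^sup>2"
  have lin: "l = 0" if "\<And>t::real. 2 * t * l + r \<ge> 0" for l r
  proof (rule ccontr)
    assume "l \<noteq> 0"
    then have "2 * (- (r + 1) / (2 * l)) * l + r = -1" by (simp add: field_simps)
    then show False using that[of "- (r + 1) / (2 * l)"] by simp
  qed
  have uu: "uu \<ge> 0" using psd[of 1 0 0] by simp
  have vv: "vv \<ge> 0" using psd[of 0 1 0] by simp
  have D: "D \<ge> 0"
  proof (cases "uu = 0")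
    case True
    have "uv = 0"
      by (rule lin[of _ vv]) (use psd[of _ 1 0] True in \<open>simp add: algebra_simps\<close>)
    then show ?thesis using True by (simp add: D_def)
  next
    case False
    have "uu * D \<ge> 0"
      using psd[of "- uv" uu 0] by (simp add: D_def algebra_simps power2_eq_square)
    then show ?thesis using False uu by (simp add: zero_le_mult_iff)
  qed
  show ?thesis
  proof (cases "D = 0")
    case False
    have "D * ?det \<ge> 0"
      using psd[of "uv * vz - vv * uz" "uv * uz - uu * vz" D]
      by (simp add: D_def algebra_simps power2_eq_square)
    then show ?thesis using D False by (simp add: zero_le_mult_iff)
  next
    case True
    have "uu * vz - uv * uz = 0"
    proof (rule lin[of _ zz])
      fix t :: real
      have "(t * - uv)\<^sup>2 * uu + (t * uu)\<^sup>2 * vv + 2 * (t * - uv) * (t * uu) * uv = t\<^sup>2 * uu * D"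
        by (simp add: D_def algebra_simps power2_eq_square)
      then show "2 * t * (uu * vz - uv * uz) + zz \<ge> 0"
        using psd[of "t * - uv" "t * uu" 1] True by (simp add: algebra_simps)
    qed
    moreover have "vv * uz - uv * vz = 0"
    proof (rule lin[of _ zz])
      fix t :: real
      have "(t * vv)\<^sup>2 * uu + (t * - uv)\<^sup>2 * vv + 2 * (t * vv) * (t * - uv) * uv = t\<^sup>2 * vv * D"
        by (simp add: D_def algebra_simps power2_eq_square)
      then show "2 * t * (vv * uz - uv * vz) + zz \<ge> 0"
        using psd[of "t * vv" "t * - uv" 1] True by (simp add: algebra_simps)
    qed
    moreover have "?det = zz * D - vz * (uu * vz - uv * uz) - uz * (vv * uz - uv * vz)"
      by (simp add: D_def algebra_simps power2_eq_square)
    ultimately show ?thesis using True by simp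
  qed
qed

text \<open>
  In Lorentzian coordinates, with \<open>u0\<close> the time component and \<open>uu, uv, \<dots>\<close> the Gram matrix of the space components,
  the left-hand side is half the Wronskian of \<open>z0\<^sup>2 - zz\<close> along \<open>u\<close> and \<open>v\<close>. It is
  non-decreasing in \<open>u0\<close> and \<open>v0\<close>, so both vectors may be moved to the boundary of the light cone. There it
  is a quadratic polynomial in \<open>z0\<close> whose discriminant is, up to a negative factor, the Gram determinant.
\<close>

lemma lorentz_wronskian_nonneg:
  fixes u0 v0 z0 uu vv zz uv uz vz :: real
  assumes psd: "\<And>a b c. a\<^sup>2 * uu + b\<^sup>2 * vv + c\<^sup>2 * zz + 2 * a * b * uv + 2 * a * c * uz + 2 * b * c * vz \<ge> 0"
    and u0: "u0 \<ge> 0" "u0\<^sup>2 \<ge> uu" and v0: "v0 \<ge> 0" "v0\<^sup>2 \<ge> vv"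
  shows "2 * (u0 * z0 - uz) * (v0 * z0 - vz) - (z0\<^sup>2 - zz) * (u0 * v0 - uv) \<ge> 0"
proof -
  define r where "r = sqrt uu"
  define s where "s = sqrt vv"
  define w where "w = sqrt zz"
  have nn: "uu \<ge> 0" "vv \<ge> 0" "zz \<ge> 0"
    using psd[of 1 0 0] psd[of 0 1 0] psd[of 0 0 1] by simp_all
  have sq: "r\<^sup>2 = uu" "s\<^sup>2 = vv" "w\<^sup>2 = zz" "r \<ge> 0" "s \<ge> 0" "w \<ge> 0"
    using nn by (simp_all add: r_def s_def w_def)
  have ru: "r \<le> u0" using u0 by (simp add: r_def real_le_lsqrt)
  have sv: "s \<le> v0" using v0 by (simp add: s_def real_le_lsqrt)
  have cs: "\<bar>k\<bar> \<le> p * q"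
    if "\<And>a b. a\<^sup>2 * p\<^sup>2 + b\<^sup>2 * q\<^sup>2 + 2 * a * b * k \<ge> 0" "p \<ge> 0" "q \<ge> 0" for k p q :: real
  proof -
    have "k\<^sup>2 \<le> (p * q)\<^sup>2"
      using gram_det_nonneg[of "p\<^sup>2" "q\<^sup>2" 1 k 0 0] that(1)
      by (simp add: power_mult_distrib add_increasing2 algebra_simps)
    then show ?thesis using that by (simp add: abs_le_square_iff[symmetric])
  qed
  have uv: "\<bar>uv\<bar> \<le> r * s" using psd[of _ _ 0] sq by (intro cs) simp_all
  have uz: "\<bar>uz\<bar> \<le> r * w" using psd[of _ 0 _] sq by (intro cs) simp_all
  have vz: "\<bar>vz\<bar> \<le> s * w" using psd[of 0 _ _] sq by (intro cs) simp_all
  let ?W = "\<lambda>a b. 2 * (a * z0 - uz) * (b * z0 - vz) - (z0\<^sup>2 - zz) * (a * b - uv)"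
  have slope: "b * (z0\<^sup>2 + zz) - 2 * z0 * k \<ge> 0" if "\<bar>k\<bar> \<le> q * w" "q \<le> b" "q \<ge> 0" for b k q
  proof -
    have "2 * z0 * k \<le> 2 * \<bar>z0\<bar> * \<bar>k\<bar>" using abs_ge_self[of "z0 * k"] by (simp add: abs_mult)
    also have "\<dots> \<le> 2 * \<bar>z0\<bar> * (q * w)" using that by (intro mult_left_mono) auto
    also have "\<dots> = q * (2 * \<bar>z0\<bar> * w)" by simp
    also have "\<dots> \<le> b * (z0\<^sup>2 + zz)"
      using that sum_squares_bound[of "\<bar>z0\<bar>" w] sq by (intro mult_mono) auto
    finally show ?thesis by simp
  qed
  have "?W u0 v0 - ?W r v0 = (u0 - r) * (v0 * (z0\<^sup>2 + zz) - 2 * z0 * vz)"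
    by (simp add: algebra_simps power2_eq_square)
  moreover have "\<dots> \<ge> 0" using ru slope[OF vz sv] sq by (intro mult_nonneg_nonneg) auto
  moreover have "?W r v0 - ?W r s = (v0 - s) * (r * (z0\<^sup>2 + zz) - 2 * z0 * uz)"
    by (simp add: algebra_simps power2_eq_square)
  moreover have "\<dots> \<ge> 0" using sv slope[OF uz order_refl] sq by (intro mult_nonneg_nonneg) auto
  moreover have "?W r s \<ge> 0"
  proof -
    define A where "A = r * s + uv"
    define B where "B = r * vz + s * uz"
    define C where "C = 2 * uz * vz + zz * (r * s - uv)"
    have W: "?W r s = A * z0\<^sup>2 - 2 * B * z0 + C"
      by (simp add: A_def B_def C_def algebra_simps power2_eq_square)
    have "A * C - B\<^sup>2 = r\<^sup>2 * s\<^sup>2 * zz + 2 * uv * uz * vz - r\<^sup>2 * vz\<^sup>2 - s\<^sup>2 * uz\<^sup>2 - zz * uv\<^sup>2"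
      by (simp add: A_def B_def C_def algebra_simps power2_eq_square)
    also have "\<dots> \<ge> 0" using gram_det_nonneg[OF psd] sq by simp
    finally have disc: "B\<^sup>2 \<le> A * C" by simp
    have A: "A \<ge> 0" using uv by (simp add: A_def)
    show ?thesis
    proof (cases "A = 0")
      case True
      then have "B = 0" using disc by simp
      have "- (2 * uz * vz) \<le> 2 * (\<bar>uz\<bar> * \<bar>vz\<bar>)"
        using abs_ge_minus_self[of "uz * vz"] by (simp add: abs_mult)
      also have "\<dots> \<le> 2 * ((r * w) * (s * w))" using uz vz by (intro mult_left_mono mult_mono) auto
      also have "\<dots> = zz * (r * s - uv)"
      proof -
        have "uv = - (r * s)" using True by (simp add: A_def)
        then show ?thesis by (simp add: sq(3)[symmetric] algebra_simps power2_eq_square)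
      qed
      finally have "C \<ge> 0" by (simp add: C_def)
      then show ?thesis unfolding W using True \<open>B = 0\<close> by simp
    next
      case False
      have "A * (A * z0\<^sup>2 - 2 * B * z0 + C) = (A * z0 - B)\<^sup>2 + (A * C - B\<^sup>2)"
        by (simp add: algebra_simps power2_eq_square)
      also have "\<dots> \<ge> 0" using disc by simp
      finally show ?thesis unfolding W using A False by (simp add: zero_le_mult_iff)
    qed
  qed
  ultimately show ?thesis by linarith
qed

text \<open>
  A quadratic form is described by the parallelogram law and homogeneity, the form in which it enters the
  estimate of its values at linear combinations.
\<close>

definition psd_quadratic :: "nat \<Rightarrow> ((nat \<Rightarrow> real) \<Rightarrow> real) \<Rightarrow> bool" where
  "psd_quadratic n W \<longleftrightarrow> (\<forall>z\<in>Rn n. W z \<ge> 0) \<and>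
     (\<forall>x y. W (\<lambda>i. x i + y i) + W (\<lambda>i. x i - y i) = 2 * W x + 2 * W y) \<and>
     (\<forall>t x. W (\<lambda>i. t * x i) = t\<^sup>2 * W x)"

text \<open>
  By the parallelogram law and positivity, \<open>W (a + b) \<le> 2 W a + 2 W b\<close>; this is iterated. The constant is crude,
  but any constant serves.
\<close>

lemma psd_quadratic_sum_le:
  assumes W: "psd_quadratic n W" and "finite J" "\<And>j. j \<in> J \<Longrightarrow> z j \<in> Rn n"
  shows "W (\<lambda>i. \<Sum>j\<in>J. w j * z j i) \<le> 2 ^ card J * (\<Sum>j\<in>J. (w j)\<^sup>2 * W (z j))"
  using assms(2,3)
proof (induction J rule: finite_induct)
  case empty
  have "\<And>t x. W (\<lambda>i. t * x i) = t\<^sup>2 * W x" using W unfolding psd_quadratic_def by blast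
  from this[of 0 "\<lambda>_. 0"] show ?case by simp
next
  case (insert j J)
  let ?a = "\<lambda>i. w j * z j i" and ?b = "\<lambda>i. \<Sum>j\<in>J. w j * z j i"
  have "(\<lambda>i. ?a i - ?b i) \<in> Rn n"
    using insert.prems by (auto simp: Rn_def intro!: sum.neutral)
  then have nn: "W (\<lambda>i. ?a i - ?b i) \<ge> 0" using W unfolding psd_quadratic_def by blast
  have par: "\<And>x y. W (\<lambda>i. x i + y i) + W (\<lambda>i. x i - y i) = 2 * W x + 2 * W y"
    and hom: "\<And>t x. W (\<lambda>i. t * x i) = t\<^sup>2 * W x"
    using W unfolding psd_quadratic_def by blast+
  note par[of ?a ?b]
  moreover have "W ?a = (w j)\<^sup>2 * W (z j)" by (rule hom)
  moreover have "W ?b \<le> 2 ^ card J * (\<Sum>j\<in>J. (w j)\<^sup>2 * W (z j))"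
    using insert by simp
  moreover have "(w j)\<^sup>2 * W (z j) * 1 \<le> (w j)\<^sup>2 * W (z j) * 2 ^ card J"
    using insert.prems W unfolding psd_quadratic_def by (intro mult_left_mono) auto
  ultimately have "W (\<lambda>i. ?a i + ?b i)
      \<le> 2 * ((w j)\<^sup>2 * W (z j) * 2 ^ card J) + 2 * (2 ^ card J * (\<Sum>j\<in>J. (w j)\<^sup>2 * W (z j)))"
    using nn by linarith
  then show ?case using insert.hyps by (simp add: algebra_simps)
qed

text \<open>
  Real-rootedness of \<open>t \<mapsto> p (t e - x)\<close> is the reverse Cauchy--Schwarz inequality for the bilinear form \<open>B\<close> of
  \<open>p\<close> against \<open>e\<close>. Hence \<open>B\<close> has one positive direction \<open>e\<close>, is negative semidefinite on its complement, and
  the hyperbolicity cone is the forward light cone.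
\<close>

lemma hyperbolic_quadratic_wronskian:
  assumes p: "p \<in> Hyp n 2 e" and e: "e \<in> Rn n"
    and u: "u \<in> hyp_cone n p e" and v: "v \<in> hyp_cone n p e"
  shows "psd_quadratic n (\<lambda>z. dirderiv u (peval p) z * dirderiv v (peval p) z
             - peval p z * dirderiv u (dirderiv v (peval p)) z)"
proof -
  have "p \<in> forms n 2" using p by (simp add: Hyp_def)
  then obtain B where B: "sym_bilinear B" and pB: "\<And>x. peval p x = B x x"
    and pC: "\<And>e x (t::complex). peval p (\<lambda>i. t * of_real (e i) - of_real (x i))
        = of_real (B e e) * t\<^sup>2 - 2 * of_real (B e x) * t + of_real (B x x)"
    using quadratic_form_polarization by blast
  note lin = sym_bilinear_line[OF B] sym_bilinear_scale[OF B]
  have sym: "B x y = B y x" for x y using B unfolding sym_bilinear_def by blast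
  have add: "B (\<lambda>i. x i + y i) z = B x z + B y z" "B z (\<lambda>i. x i + y i) = B z x + B z y"
    "B (\<lambda>i. x i - y i) z = B x z - B y z" "B z (\<lambda>i. x i - y i) = B z x - B z y" for x y z
    using lin(1)[of x 1 y z] lin(2)[of z x 1 y] lin(1)[of x "-1" y z] lin(2)[of z x "-1" y]
    by simp_all
  have ee: "B e e > 0" using p by (simp add: Hyp_def pB)
  have disc: "(B e x)\<^sup>2 \<ge> B e e * B x x" if x: "x \<in> Rn n" for x
  proof (rule ccontr)
    assume "\<not> ?thesis"
    then have D: "B e e * B x x - (B e x)\<^sup>2 > 0" by simp
    define d where "d = sqrt (B e e * B x x - (B e x)\<^sup>2)"
    have d: "d > 0" "d\<^sup>2 = B e e * B x x - (B e x)\<^sup>2" using D by (simp_all add: d_def)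
    \<comment> \<open>A root with positive imaginary part, from the quadratic formula with negative discriminant.\<close>
    define t where "t = Complex (B e x / B e e) (d / B e e)"
    have "peval p (\<lambda>i. t * of_real (e i) - of_real (x i)) = 0"
    proof -
      have "B e e * ((B e x / B e e)\<^sup>2 - (d / B e e)\<^sup>2) - 2 * B e x * (B e x / B e e) + B x x
          = (B e e * B x x - (B e x)\<^sup>2 - d\<^sup>2) / B e e"
        using ee by (simp add: field_simps power2_eq_square)
      moreover have "\<dots> = 0" using d by simp
      moreover have "Re (t\<^sup>2) = (B e x / B e e)\<^sup>2 - (d / B e e)\<^sup>2"
        "Im (t\<^sup>2) = 2 * (B e x / B e e) * (d / B e e)"
        by (simp_all add: t_def power2_eq_square)
      ultimately show ?thesis
        unfolding pC complex_eq_iff using ee by (simp add: t_def)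
    qed
    then have "t \<in> \<real>" using p x by (auto simp: Hyp_def)
    then show False using d ee by (auto simp: t_def complex_is_Real_iff)
  qed
  have cone: "B e x \<ge> 0 \<and> B x x \<ge> 0" if x: "x \<in> hyp_cone n p e" for x
  proof -
    define d where "d = sqrt ((B e x)\<^sup>2 - B e e * B x x)"
    have "x \<in> Rn n" using x by (simp add: hyp_cone_def)
    from disc[OF this] have d: "d \<ge> 0" "d\<^sup>2 = (B e x)\<^sup>2 - B e e * B x x" by (simp_all add: d_def)
    \<comment> \<open>The smaller of the two real roots; the cone condition makes it non-negative.\<close>
    define t where "t = (B e x - d) / B e e"
    have "peval p (\<lambda>i. t * e i - x i) = t\<^sup>2 * B e e - 2 * t * B e x + B x x"
      by (simp add: pB add lin sym[of x e] power2_eq_square algebra_simps)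
    also have "\<dots> = (d\<^sup>2 - ((B e x)\<^sup>2 - B e e * B x x)) / B e e"
      using ee by (simp add: t_def field_simps power2_eq_square)
    also have "\<dots> = 0" using d by simp
    finally have "t \<ge> 0" using x by (simp add: hyp_cone_def)
    then have le: "d \<le> B e x" using ee by (simp add: t_def zero_le_divide_iff)
    then have "d\<^sup>2 \<le> (B e x)\<^sup>2" using d(1) by (intro power_mono) auto
    then have "B e e * B x x \<ge> 0" using d(2) by simp
    then show ?thesis using le d(1) ee by (simp add: zero_le_mult_iff)
  qed
  have d1: "dirderiv a (peval p) z = 2 * B a z" for a z
  proof -
    have "(\<lambda>t. peval p (\<lambda>i. z i + t * a i)) = (\<lambda>t. B z z + 2 * t * B a z + t\<^sup>2 * B a a)"
      by (simp add: pB lin sym[of z a] power2_eq_square algebra_simps)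
    moreover have "((\<lambda>t. B z z + 2 * t * B a z + t\<^sup>2 * B a a) has_field_derivative 2 * B a z) (at 0)"
      by (auto intro!: derivative_eq_intros)
    ultimately show ?thesis by (simp add: dirderiv_def DERIV_imp_deriv)
  qed
  have d2: "dirderiv u (dirderiv v (peval p)) z = 2 * B u v" for z
  proof -
    have "((\<lambda>t. 2 * B v z + t * (2 * B v u)) has_field_derivative 2 * B v u) (at 0)"
      by (auto intro!: derivative_eq_intros)
    then show ?thesis
      unfolding dirderiv_def[of u] by (simp add: d1 lin sym[of u v] algebra_simps DERIV_imp_deriv)
  qed
  have "2 * B u z * (2 * B v z) - B z z * (2 * B u v) \<ge> 0" if z: "z \<in> Rn n" for z
  proof -
    \<comment> \<open>The form on the space components: \<open>B e e * B x y = B e x * B e y - G x y\<close>.\<close>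
    define G where "G x y = B e x * B e y - B e e * B x y" for x y
    have uv: "u \<in> Rn n" "v \<in> Rn n" using u v by (simp_all add: hyp_cone_def)
    have "a\<^sup>2 * G u u + b\<^sup>2 * G v v + c\<^sup>2 * G z z
        + 2 * a * b * G u v + 2 * a * c * G u z + 2 * b * c * G v z \<ge> 0" for a b c
    proof -
      define x where "x = (\<lambda>i. (a * u i + b * v i) + c * z i)"
      have "x \<in> Rn n" using uv z by (simp add: Rn_def x_def)
      then have "G x x \<ge> 0" using disc by (simp add: G_def power2_eq_square)
      moreover have "G x x = a\<^sup>2 * G u u + b\<^sup>2 * G v v + c\<^sup>2 * G z z
        + 2 * a * b * G u v + 2 * a * c * G u z + 2 * b * c * G v z"
        unfolding G_def x_def add lin sym[of v u] sym[of z u] sym[of z v]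
        by (simp add: algebra_simps power2_eq_square)
      ultimately show ?thesis by simp
    qed
    moreover have "(B e u)\<^sup>2 \<ge> G u u" "(B e v)\<^sup>2 \<ge> G v v"
      using cone[OF u] cone[OF v] ee by (simp_all add: G_def power2_eq_square)
    ultimately have "2 * (B e u * B e z - G u z) * (B e v * B e z - G v z)
        - ((B e z)\<^sup>2 - G z z) * (B e u * B e v - G u v) \<ge> 0"
      using cone[OF u] cone[OF v] by (intro lorentz_wronskian_nonneg) auto
    then have "(B e e)\<^sup>2 * (2 * B u z * B v z - B z z * B u v) \<ge> 0"
      by (simp add: G_def algebra_simps power2_eq_square)
    then have "2 * B u z * B v z - B z z * B u v \<ge> 0"
      using ee by (simp add: zero_le_mult_iff)
    then show ?thesis by (simp add: algebra_simps)
  qed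
  then show ?thesis
    unfolding psd_quadratic_def d1 d2 pB add lin
    by (intro conjI allI ballI; simp add: algebra_simps power2_eq_square)
qed

text \<open>
  Comparing degrees of homogeneity at a point where \<open>q\<close> does not vanish gives \<open>y = k (d - 1)\<close>. Then \<open>d = 1\<close>
  contradicts \<open>y > 0\<close>, \<open>d = 2\<close> makes the Wronskian a quadratic form, and \<open>d \<ge> 3\<close> gives \<open>2 k \<le> y\<close>.
\<close>

lemma hyperwron_cases:
  assumes "hyperwron m q" "q \<in> forms m (2 * y)" "y > 0" "x0 \<in> Rn m" "peval q x0 \<noteq> 0"
  obtains (product) k a b f g where "0 < k" "2 * k \<le> y" "hform m y a" "hform m y b"
      "hform m (y + k) f" "hform m (y - k) g" "\<And>x. x \<in> Rn m \<Longrightarrow> peval q x = a x * b x - f x * g x"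
  | (psd) n W \<phi> where "psd_quadratic n W" "\<And>i. i < n \<Longrightarrow> hform m y (\<phi> i)"
      "\<And>x. x \<in> Rn m \<Longrightarrow> peval q x = W (\<lambda>i. if i < n then \<phi> i x else 0)"
proof -
  obtain k d n e p u v \<phi> where kd: "k > 0" "d > 0" "n > 0" and e: "e \<in> Rn n" and p: "p \<in> Hyp n d e"
    and uv: "u \<in> hyp_cone n p e" "v \<in> hyp_cone n p e"
    and \<phi>: "\<And>i. i < n \<Longrightarrow> \<phi> i \<in> forms m k"
    and q: "\<And>x. x \<in> Rn m \<Longrightarrow> peval q x = dirderiv u (peval p) (poly_map n \<phi> x) * dirderiv v (peval p) (poly_map n \<phi> x)
             - peval p (poly_map n \<phi> x) * dirderiv u (dirderiv v (peval p)) (poly_map n \<phi> x)"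
    using assms(1) unfolding hyperwron_def Let_def by metis
  have uvR: "u \<in> Rn n" "v \<in> Rn n" using uv by (simp_all add: hyp_cone_def)
  have hp: "hform n d (peval p)" using p by (simp add: Hyp_def hform_peval)
  have comp: "hform m (k * j) (\<lambda>x. h (poly_map n \<phi> x))" if "hform n j h" for h j
    unfolding poly_map_def using \<phi> by (intro hform_compose[OF that] hform_peval)
  define a where "a x = dirderiv u (peval p) (poly_map n \<phi> x)" for x
  define b where "b x = dirderiv v (peval p) (poly_map n \<phi> x)" for x
  define f where "f x = peval p (poly_map n \<phi> x)" for x
  define g where "g x = dirderiv u (dirderiv v (peval p)) (poly_map n \<phi> x)" for x
  have forms: "hform m (k * (d - 1)) a" "hform m (k * (d - 1)) b" "hform m (k * d) f"
      "hform m (k * (d - 1 - 1)) g"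
    unfolding a_def b_def f_def g_def
    by (intro comp hform_dirderiv hp uvR)+
  have qab: "peval q x = a x * b x - f x * g x" if "x \<in> Rn m" for x
    using q[OF that] by (simp add: a_def b_def f_def g_def)
  have "hform m (2 * (k * (d - 1))) (\<lambda>x. a x * b x - f x * g x)"
  proof (cases "d = 1")
    case True
    \<comment> \<open>The degree of the second derivative is truncated here, but it is zero, a form of any degree.\<close>
    have "dirderiv u (dirderiv v (peval p)) z = 0" if "z \<in> Rn n" for z
      using hform_dirderiv[OF hp uvR(2)] True that uvR by (intro dirderiv_degree_0) auto
    then have "g x = 0" for x unfolding g_def poly_map_def by (simp add: Rn_def)
    then show ?thesis using hform_mult[OF forms(1,2)] True by simp
  next
    case False
    then have "k * (d - 1) + k * (d - 1) = k * d + k * (d - 1 - 1)"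
      using kd(2) by (cases d; cases "d - 1") (auto simp: algebra_simps)
    then show ?thesis
      using hform_diff[OF hform_mult[OF forms(1,2)], of "\<lambda>x. f x * g x"] hform_mult[OF forms(3,4)]
      by (simp add: mult_2)
  qed
  then have "hform m (2 * (k * (d - 1))) (peval q)" by (rule hform_cong) (use qab in auto)
  from hform_scale[OF this assms(4), of 2] hform_scale[OF hform_peval[OF assms(2)] assms(4), of 2]
  have "(2::real) ^ (2 * y) = 2 ^ (2 * (k * (d - 1)))" using assms(5) by simp
  then have y: "y = k * (d - 1)" by (simp add: power_inject_exp)
  then have "d \<noteq> 1" using assms(3) by auto
  show ?thesis
  proof (cases "d = 2")
    case True
    show ?thesis
      using hyperbolic_quadratic_wronskian[OF p[unfolded True] e uv] q \<phi> y True
      by (intro psd[of n _ "\<lambda>i. peval (\<phi> i)"]) (auto simp: poly_map_def hform_peval)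
  next
    case False
    define d' where "d' = d - 3"
    have d: "d = d' + 3" using False \<open>d \<noteq> 1\<close> kd(2) by (simp add: d'_def)
    have deg: "k * (d - 1) = y" "k * d = y + k" "k * (d - 1 - 1) = y - k" "2 * k \<le> y"
      unfolding y d by (simp_all add: algebra_simps)
    show ?thesis
      using forms unfolding deg by (intro product[OF kd(1) deg(4) _ _ _ _ qab])
  qed
qed

section \<open>A non-negative form that is far from sums of squares\<close>

text \<open>
  An \<open>n\<close>-th difference annihilates polynomials of degree below \<open>n\<close>. Pascal's rule turns the sum for \<open>n + 1\<close> and \<open>g\<close>
  into the sum for \<open>n\<close> and \<open>z \<mapsto> g z - g (z + 1)\<close>, and this difference lowers the degree of a power.
\<close>

lemma alternating_binomial_power_sum:
  assumes "k < n"
  shows "(\<Sum>i\<le>n. (-1) ^ i * real (n choose i) * real i ^ k) = 0"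
  using assms
proof (induction n arbitrary: k)
  case (Suc n)
  let ?S = "\<lambda>g. \<Sum>i\<le>n. (-1) ^ i * real (n choose i) * g (real i)"
  have pascal: "(\<Sum>i\<le>Suc n. (-1) ^ i * real (Suc n choose i) * g (real i)) = ?S (\<lambda>z. g z - g (z + 1))"
    for g :: "real \<Rightarrow> real"
  proof -
    have "(\<Sum>i\<le>Suc n. (-1) ^ i * real (Suc n choose i) * g (real i))
        = g 0 + (\<Sum>i\<le>n. (-1) ^ Suc i * real (n choose Suc i) * g (real (Suc i)))
          + (\<Sum>i\<le>n. (-1) ^ Suc i * real (n choose i) * g (real (Suc i)))"
      by (subst sum.atMost_Suc_shift) (simp add: algebra_simps sum.distrib sum_subtractf sum_negf)
    also have "g 0 + (\<Sum>i\<le>n. (-1) ^ Suc i * real (n choose Suc i) * g (real (Suc i)))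
        = (\<Sum>i\<le>Suc n. (-1) ^ i * real (n choose i) * g (real i))"
      by (subst sum.atMost_Suc_shift) simp
    also have "\<dots> = ?S g" by simp
    finally show ?thesis by (simp add: algebra_simps sum_subtractf sum_negf)
  qed
  have "(z + 1) ^ k = (\<Sum>l<k. real (k choose l) * z ^ l) + z ^ k" for z :: real
    by (simp add: binomial_ring lessThan_Suc_atMost[symmetric])
  then have "?S (\<lambda>z. z ^ k - (z + 1) ^ k)
      = - (\<Sum>i\<le>n. \<Sum>l<k. real (k choose l) * ((-1) ^ i * real (n choose i) * real i ^ l))"
    by (simp add: sum_distrib_left sum_negf mult_ac)
  also have "\<dots> = - (\<Sum>l<k. real (k choose l) * (\<Sum>i\<le>n. (-1) ^ i * real (n choose i) * real i ^ l))"
    by (subst sum.swap) (simp add: sum_distrib_left)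
  also have "\<dots> = 0" using Suc by simp
  finally show ?case using pascal[of "\<lambda>z. z ^ k"] by simp
qed simp

text \<open>
  A point of the affine chart in which the fourth coordinate is 1.
\<close>

definition grid_point :: "nat \<times> nat \<times> nat \<Rightarrow> nat \<Rightarrow> real" where
  "grid_point p n = (case p of (i, j, k) \<Rightarrow>
     if n = 0 then real i else if n = 1 then real j else if n = 2 then real k
     else if n = 3 then 1 else 0)"

definition grid :: "nat \<Rightarrow> (nat \<times> nat \<times> nat) set" where
  "grid y = {..y - 1} \<times> {..1} \<times> {..1}"

text \<open>
  The coefficients of the difference operator of order \<open>y - 1\<close>, 1, 1 in the three directions, at the origin,
  with the sign that makes the weight of the origin 1.
\<close>

definition grid_weight :: "nat \<Rightarrow> nat \<times> nat \<times> nat \<Rightarrow> real" where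
  "grid_weight y p = (case p of (i, j, k) \<Rightarrow> (-1) ^ (i + j + k) * real ((y - 1) choose i))"

lemma grid_point_Rn: "4 \<le> m \<Longrightarrow> grid_point p \<in> Rn m"
  by (auto simp: grid_point_def Rn_def split: prod.splits)

lemma finite_grid [simp]: "finite (grid y)"
  by (simp add: grid_def)

text \<open>
  The operator factorizes on monomials \<open>x\<^sub>0^\<beta>\<^sub>0 x\<^sub>1^\<beta>\<^sub>1 x\<^sub>2^\<beta>\<^sub>2\<close> and could be non-zero only if \<open>\<beta>\<^sub>0 \<ge> y - 1\<close>,
  \<open>\<beta>\<^sub>1 \<ge> 1\<close> and \<open>\<beta>\<^sub>2 \<ge> 1\<close>, that is, in degree at least \<open>y + 1\<close>.
\<close>

lemma sum_grid_weight_hform: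
  assumes "hform m y f" "4 \<le> m" "y > 0"
  shows "(\<Sum>p\<in>grid y. grid_weight y p * f (grid_point p)) = 0"
proof -
  obtain c where c: "\<And>x. x \<in> Rn 4 \<Longrightarrow> f x = (\<Sum>\<beta>\<in>exps 4 y. c \<beta> * mon 4 \<beta> x)"
    using hform_restrict[OF assms(1,2)] unfolding hform_def by blast
  have zero: "(\<Sum>p\<in>grid y. grid_weight y p * mon 4 \<beta> (grid_point p)) = 0" if \<beta>: "\<beta> \<in> exps 4 y" for \<beta>
  proof -
    define A where "A = (\<Sum>i\<le>y - 1. (-1) ^ i * real ((y - 1) choose i) * real i ^ \<beta> 0)"
    define B where "B l = (\<Sum>j\<le>(1::nat). (-1) ^ j * real j ^ \<beta> l)" for l
    have "(\<Sum>p\<in>grid y. grid_weight y p * mon 4 \<beta> (grid_point p))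
        = (\<Sum>i\<le>y - 1. \<Sum>j\<le>1. \<Sum>k\<le>1. ((-1) ^ i * real ((y - 1) choose i) * real i ^ \<beta> 0)
            * (((-1) ^ j * real j ^ \<beta> 1) * ((-1) ^ k * real k ^ \<beta> 2)))"
      unfolding grid_def sum.cartesian_product'
      by (intro sum.cong refl)
        (simp add: grid_weight_def mon_def grid_point_def eval_nat_numeral power_add mult_ac)
    also have "\<dots> = A * (B 1 * B 2)"
      by (simp only: A_def B_def sum_product) (simp only: sum_distrib_left)
    also have "\<dots> = 0"
    proof -
      have "(\<Sum>i<4. \<beta> i) = y" using \<beta> by (simp add: exps_def)
      then have "\<beta> 0 + \<beta> 1 + \<beta> 2 \<le> y" by (simp add: eval_nat_numeral)
      then consider "\<beta> 0 < y - 1" | "\<beta> 1 = 0" | "\<beta> 2 = 0" using assms(3) by linarith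
      then show ?thesis
      proof cases
        case 1
        then show ?thesis using alternating_binomial_power_sum by (simp add: A_def)
      qed (simp_all add: B_def)
    qed
    finally show ?thesis .
  qed
  have "(\<Sum>p\<in>grid y. grid_weight y p * f (grid_point p))
      = (\<Sum>\<beta>\<in>exps 4 y. c \<beta> * (\<Sum>p\<in>grid y. grid_weight y p * mon 4 \<beta> (grid_point p)))"
    by (simp add: c grid_point_Rn sum_distrib_left mult_ac) (rule sum.swap)
  also have "\<dots> = 0" using zero by simp
  finally show ?thesis .
qed

definition choi_lam :: "real \<Rightarrow> real \<Rightarrow> real \<Rightarrow> real \<Rightarrow> real" where
  "choi_lam a b c g = g ^ 4 + a\<^sup>2 * b\<^sup>2 + b\<^sup>2 * c\<^sup>2 + c\<^sup>2 * a\<^sup>2 - 4 * a * b * c * g"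

text \<open>
  The inequality between arithmetic and geometric mean of the four positive terms; the two
  decompositions correspond to the sign of \<open>a b\<close>.
\<close>

lemma choi_lam_nonneg: "choi_lam a b c g \<ge> 0"
proof (cases "a * b \<ge> 0")
  case True
  have "choi_lam a b c g = (g\<^sup>2 - a * b)\<^sup>2 + c\<^sup>2 * (a - b)\<^sup>2 + 2 * (a * b) * (g - c)\<^sup>2"
    by (simp add: choi_lam_def power2_eq_square power4_eq_xxxx algebra_simps)
  then show ?thesis using True by simp
next
  case False
  have "choi_lam a b c g = (g\<^sup>2 + a * b)\<^sup>2 + c\<^sup>2 * (a + b)\<^sup>2 + 2 * (- (a * b)) * (g + c)\<^sup>2"
    by (simp add: choi_lam_def power2_eq_square power4_eq_xxxx algebra_simps)
  moreover have "2 * (- (a * b)) * (g + c)\<^sup>2 \<ge> 0" using False by (intro mult_nonneg_nonneg) auto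
  moreover have "(g\<^sup>2 + a * b)\<^sup>2 \<ge> 0" "c\<^sup>2 * (a + b)\<^sup>2 \<ge> 0" by simp_all
  ultimately show ?thesis by linarith
qed

text \<open>
  The Choi--Lam quartic has the zeros \<open>(1,0,0,0)\<close>, \<open>(0,1,0,0)\<close>, \<open>(0,0,1,0)\<close>, \<open>(1,1,1,1)\<close>, \<open>(1,-1,-1,1)\<close>, \<open>(-1,1,-1,1)\<close>,
  \<open>(-1,-1,1,1)\<close>, and the quadrics through these seven points also meet in \<open>(0,0,0,1)\<close>. The substitution below is the
  linear change of coordinates, up to scaling, that takes the eight points to the vertices of the unit cube, the last one to the
  origin. The linear factors vanish on the remaining layers \<open>x\<^sub>0 = 2, \<dots>, y - 1\<close> of the grid.
\<close>

definition cube_form :: "nat \<Rightarrow> (nat \<Rightarrow> real) \<Rightarrow> real" where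
  "cube_form y x = choi_lam (x 0 + x 1 - x 2) (x 1 + x 2 - x 0) (x 0 + x 2 - x 1)
       (x 0 + x 1 + x 2 - 2 * x 3) * (\<Prod>j\<in>{2..<y}. (x 0 - real j * x 3)\<^sup>2)"

lemma cube_form_nonneg: "cube_form y x \<ge> 0"
  by (simp add: cube_form_def choi_lam_nonneg prod_nonneg)

lemma hform_cube_form:
  assumes "m \<ge> 4" "y \<ge> 2"
  shows "hform m (2 * y) (cube_form y)"
proof -
  have x: "hform m 1 (\<lambda>x. x i)" if "i < 4" for i
    using that assms by (intro hform_coord) auto
  have sq: "hform m 2 (\<lambda>x. (f x)\<^sup>2)" if "hform m 1 f" for f
    using hform_power[OF that, of 2] by simp
  have prod: "hform m 4 (\<lambda>x. f x * g x)" if "hform m 2 f" "hform m 2 g" for f g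
    using hform_mult[OF that] by simp
  have cl: "hform m 4 (\<lambda>x. choi_lam (a x) (b x) (c x) (g x))"
    if l: "hform m 1 a" "hform m 1 b" "hform m 1 c" "hform m 1 g" for a b c g
  proof -
    have "hform m 4 (\<lambda>x. (g x)\<^sup>2 * (g x)\<^sup>2 + (a x)\<^sup>2 * (b x)\<^sup>2 + (b x)\<^sup>2 * (c x)\<^sup>2
        + (c x)\<^sup>2 * (a x)\<^sup>2 - 4 * ((a x * b x) * (c x * g x)))"
      using hform_mult[OF l(1,2)] hform_mult[OF l(3,4)]
      by (intro hform_diff hform_add hform_cmult prod sq l) (simp_all add: numeral_2_eq_2)
    then show ?thesis
      by (rule hform_cong) (simp add: choi_lam_def power2_eq_square power4_eq_xxxx mult_ac)
  qed
  have "hform m (4 + (\<Sum>j\<in>{2..<y}. 2)) (cube_form y)"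
    unfolding cube_form_def
    by (intro hform_mult cl hform_prod sq hform_add hform_diff hform_cmult x) auto
  moreover have "4 + (\<Sum>j\<in>{2..<y}. 2) = 2 * y" using assms(2) by simp
  ultimately show ?thesis by simp
qed

lemma cube_form_grid_zero:
  assumes "p \<in> grid y" "p \<noteq> (0, 0, 0)"
  shows "cube_form y (grid_point p) = 0"
proof -
  obtain i j k where p: "p = (i, j, k)" "i \<le> y - 1" "j \<le> 1" "k \<le> 1"
    using assms(1) by (auto simp: grid_def)
  show ?thesis
  proof (cases "i < 2")
    case True
    then have "i = 0 \<or> i = 1" "j = 0 \<or> j = 1" "k = 0 \<or> k = 1" using p by auto
    then show ?thesis using assms(2) p(1)
      by (elim disjE) (simp_all add: cube_form_def grid_point_def choi_lam_def)
  next
    case False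
    then have "i \<in> {2..<y}" using p(2) by auto
    then have "(\<Prod>j\<in>{2..<y}. (real i - real j)\<^sup>2) = 0" by (intro prod_zero) auto
    then show ?thesis by (simp add: cube_form_def grid_point_def p(1))
  qed
qed

lemma cube_form_origin_pos: "cube_form y (grid_point (0, 0, 0)) > 0"
  by (auto simp: cube_form_def grid_point_def choi_lam_def intro!: prod_pos)

lemma abs_mon_le:
  fixes x :: "nat \<Rightarrow> real"
  assumes "\<alpha> \<in> exps m (2 * y)"
  shows "\<bar>mon m \<alpha> x\<bar> \<le> (\<Sum>i<m. (x i)\<^sup>2) ^ y"
proof -
  define r where "r = sqrt (\<Sum>i<m. (x i)\<^sup>2)"
  have r: "r \<ge> 0" "r\<^sup>2 = (\<Sum>i<m. (x i)\<^sup>2)" by (simp_all add: r_def sum_nonneg)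
  have "\<bar>mon m \<alpha> x\<bar> = (\<Prod>i<m. \<bar>x i\<bar> ^ \<alpha> i)" by (simp add: mon_def abs_prod power_abs)
  also have "\<dots> \<le> (\<Prod>i<m. r ^ \<alpha> i)"
  proof (intro prod_mono conjI power_mono)
    fix i assume "i \<in> {..<m}"
    then have "(x i)\<^sup>2 \<le> r\<^sup>2" unfolding r(2) by (intro member_le_sum) auto
    then show "\<bar>x i\<bar> \<le> r" using r(1) by (simp add: abs_le_square_iff[symmetric])
  qed auto
  also have "\<dots> = (r\<^sup>2) ^ y" using assms by (simp add: exps_def flip: power_sum power_mult)
  finally show ?thesis by (simp only: r(2))
qed

text \<open>
  For a constant \<open>C\<close>, the form is \<open>cube_form + \<epsilon> n + r\<close>, with \<open>n\<close> the \<open>y\<close>-th power of the squared norm and \<open>r\<close> a generic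
  perturbation. Since a monomial is at most \<open>n\<close> in absolute value, coefficients of size \<open>\<epsilon>\<close> divided by their
  number give \<open>\<bar>r\<bar> \<le> \<epsilon> n\<close>, which preserves non-negativity. At the grid points other than the origin the
  form is at most \<open>2 \<epsilon> n\<close>, so \<open>\<epsilon>\<close> is chosen small relative to \<open>C\<close> times the weighted sum of \<open>2 n\<close> there.
\<close>

lemma separated_generic_form:
  assumes "m \<ge> 4" "y \<ge> 2" and few: "\<And>k. 0 < k \<Longrightarrow> 2 * k \<le> y \<Longrightarrow>
      2 * card (exps m y) + card (exps m (y + k)) + card (exps m (y - k)) < card (exps m (2 * y))"
    and "C \<ge> 0"
  obtains f where "hform m (2 * y) f" "\<And>x. f x \<ge> 0"
    "C * (\<Sum>p\<in>grid y - {(0,0,0)}. (grid_weight y p)\<^sup>2 * f (grid_point p)) < f (grid_point (0,0,0))"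
    "\<And>k a b s t. 0 < k \<Longrightarrow> 2 * k \<le> y \<Longrightarrow> hform m y a \<Longrightarrow> hform m y b \<Longrightarrow>
      hform m (y + k) s \<Longrightarrow> hform m (y - k) t \<Longrightarrow>
      \<not> (\<forall>x\<in>Rn m. f x = a x * b x - s x * t x)"
proof -
  define n where "n x = (\<Sum>i<m. (x i)\<^sup>2) ^ y" for x :: "nat \<Rightarrow> real"
  have n0: "n x \<ge> 0" for x by (simp add: n_def sum_nonneg)
  have "hform m (2 * y) n"
  proof -
    have "hform m 2 (\<lambda>x. (x i)\<^sup>2)" if "i < m" for i
      using hform_power[OF hform_coord[OF that], of 2] by simp
    then have "hform m 2 (\<lambda>x. \<Sum>i<m. (x i)\<^sup>2)" by (intro hform_sum) auto
    then show ?thesis unfolding n_def by (rule hform_power)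
  qed
  define G where "G = grid y - {(0,0,0)}"
  define D where "D = C * (\<Sum>p\<in>G. (grid_weight y p)\<^sup>2 * (2 * n (grid_point p)))"
  have D: "D \<ge> 0" unfolding D_def using \<open>C \<ge> 0\<close> n0 by (intro mult_nonneg_nonneg sum_nonneg) auto
  define \<epsilon> where "\<epsilon> = cube_form y (grid_point (0,0,0)) / (D + 1)"
  have \<epsilon>: "\<epsilon> > 0" using cube_form_origin_pos D by (simp add: \<epsilon>_def)
  define M where "M = real (card (exps m (2 * y)))"
  have M: "M > 0" using few[of 1] \<open>y \<ge> 2\<close> by (simp add: M_def)
  have base: "hform m (2 * y) (\<lambda>x. cube_form y x + \<epsilon> * n x)"
    by (intro hform_add hform_cube_form hform_cmult assms) fact
  from M \<epsilon> have "\<epsilon> / M > 0" by simp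
  from generic_perturbation_not_product[OF few \<open>y \<ge> 2\<close> base this]
  obtain g where g: "\<And>\<alpha>. \<alpha> \<in> exps m (2 * y) \<Longrightarrow> \<bar>g \<alpha>\<bar> \<le> \<epsilon> / M"
    and not_prod: "\<And>k a b f h. 0 < k \<Longrightarrow> 2 * k \<le> y \<Longrightarrow> hform m y a \<Longrightarrow> hform m y b \<Longrightarrow>
      hform m (y + k) f \<Longrightarrow> hform m (y - k) h \<Longrightarrow>
      \<not> (\<forall>x\<in>Rn m. cube_form y x + \<epsilon> * n x + (\<Sum>\<alpha>\<in>exps m (2 * y). g \<alpha> * mon m \<alpha> x)
          = a x * b x - f x * h x)"
    by blast
  define r where "r x = (\<Sum>\<alpha>\<in>exps m (2 * y). g \<alpha> * mon m \<alpha> x)" for x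
  define f where "f x = cube_form y x + \<epsilon> * n x + r x" for x
  have r: "\<bar>r x\<bar> \<le> \<epsilon> * n x" for x
  proof -
    have "\<bar>r x\<bar> \<le> (\<Sum>\<alpha>\<in>exps m (2 * y). \<bar>g \<alpha> * mon m \<alpha> x\<bar>)" unfolding r_def by (rule sum_abs)
    also have "\<dots> \<le> (\<Sum>\<alpha>\<in>exps m (2 * y). \<epsilon> / M * n x)"
      unfolding abs_mult n_def using \<epsilon> M by (intro sum_mono mult_mono g abs_mon_le) auto
    also have "\<dots> = M * (\<epsilon> / M * n x)" by (simp add: M_def)
    also have "\<dots> = \<epsilon> * n x" using M by simp
    finally show ?thesis .
  qed
  show ?thesis
  proof (rule that[of f])
    have "hform m (2 * y) r" unfolding r_def by (intro hform_sum hform_cmult hform_mon)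
    then show "hform m (2 * y) f" unfolding f_def by (intro hform_add base)
    show "f x \<ge> 0" for x using r[of x] cube_form_nonneg[of y x] by (simp add: f_def)
    have le: "f (grid_point p) \<le> \<epsilon> * (2 * n (grid_point p))" if "p \<in> G" for p
      using r[of "grid_point p"] cube_form_grid_zero[of p y] that by (simp add: f_def G_def)
    have "C * (\<Sum>p\<in>G. (grid_weight y p)\<^sup>2 * f (grid_point p))
        \<le> C * (\<Sum>p\<in>G. (grid_weight y p)\<^sup>2 * (\<epsilon> * (2 * n (grid_point p))))"
      using \<open>C \<ge> 0\<close> by (intro mult_left_mono sum_mono le) auto
    also have "\<dots> = \<epsilon> * D" by (simp add: D_def sum_distrib_left mult_ac)
    also have "\<dots> < \<epsilon> * (D + 1)" using \<epsilon> by simp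
    also have "\<dots> = cube_form y (grid_point (0,0,0))" using D by (simp add: \<epsilon>_def)
    also have "\<dots> \<le> f (grid_point (0,0,0))" using r[of "grid_point (0,0,0)"] by (simp add: f_def)
    finally show "C * (\<Sum>p\<in>grid y - {(0,0,0)}. (grid_weight y p)\<^sup>2 * f (grid_point p))
        < f (grid_point (0,0,0))" by (simp add: G_def)
  qed (use not_prod in \<open>simp add: f_def r_def\<close>)
qed

theorem theorem1p1:
  fixes m y :: nat
  assumes "m > 0" and "y > 0"
    and "(m = 4 \<and> y \<ge> 4) \<or> (m = 5 \<and> y \<ge> 3) \<or> (m \<ge> 6 \<and> y \<ge> 2)"
  shows "\<exists>q \<in> forms m (2 * y). nonneg_form m q \<and> \<not> hyperwron m q"
proof -
  define l where "l = min m 6"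
  have l: "l \<le> m" "l \<ge> 4" "m \<ge> 4" "y \<ge> 2" using assms(3) by (auto simp: l_def)
  have cases: "(l = 4 \<and> y \<ge> 4) \<or> (l = 5 \<and> y \<ge> 3) \<or> (l = 6 \<and> y \<ge> 2)"
    using assms(3) by (auto simp: l_def)
  let ?o = "(0, 0, 0) :: nat \<times> nat \<times> nat"
  define G where "G = grid y - {?o}"
  obtain f where f: "hform l (2 * y) f" "\<And>x. f x \<ge> 0"
    "2 ^ card G * (\<Sum>p\<in>G. (grid_weight y p)\<^sup>2 * f (grid_point p)) < f (grid_point ?o)"
    "\<And>k a b s t. 0 < k \<Longrightarrow> 2 * k \<le> y \<Longrightarrow> hform l y a \<Longrightarrow> hform l y b \<Longrightarrow>
      hform l (y + k) s \<Longrightarrow> hform l (y - k) t \<Longrightarrow>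
      \<not> (\<forall>x\<in>Rn l. f x = a x * b x - s x * t x)"
    using separated_generic_form[OF l(2,4) card_exps_product_lt[OF cases], of "2 ^ card G"]
    unfolding G_def by auto
  obtain q where q: "q \<in> forms m (2 * y)"
      "\<And>x. x \<in> Rn m \<Longrightarrow> peval q x = f (\<lambda>i. if i < l then x i else 0)"
    using forms_of_hform[OF hform_extend[OF f(1) l(1)]] by blast
  have ql: "peval q x = f x" if "x \<in> Rn l" for x
  proof -
    have "x \<in> Rn m" "(\<lambda>i. if i < l then x i else 0) = x"
      using that l(1) by (auto simp: Rn_def fun_eq_iff)
    then show ?thesis using q(2) by metis
  qed
  have pt: "grid_point p \<in> Rn l" "grid_point p \<in> Rn m" for p
    using l by (simp_all add: grid_point_Rn)
  have sum0: "0 \<le> 2 ^ card G * (\<Sum>p\<in>G. (grid_weight y p)\<^sup>2 * f (grid_point p))"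
    using f(2) by (intro mult_nonneg_nonneg sum_nonneg) auto
  have "\<not> hyperwron m q"
  proof
    assume hw: "hyperwron m q"
    have "peval q (grid_point ?o) \<noteq> 0" using f(3) sum0 by (simp add: ql pt)
    with hw q(1) \<open>y > 0\<close> pt(2) show False
    proof (cases rule: hyperwron_cases)
      case (product k a b s t)
      have "\<forall>x\<in>Rn l. f x = a x * b x - s x * t x"
      proof
        fix x assume x: "x \<in> Rn l"
        then have "x \<in> Rn m" using l(1) by (simp add: Rn_def)
        then show "f x = a x * b x - s x * t x" using product(7) ql[OF x] by metis
      qed
      then show False
        using f(4)[OF product(1,2) product(3-6)[THEN hform_restrict[OF _ l(1)]]] by blast
    next
      case (psd n W \<phi>)
      define z where "z p = (\<lambda>i. if i < n then \<phi> i (grid_point p) else 0)" for p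
      have Wz: "W (z p) = f (grid_point p)" for p
        using psd(3)[OF pt(2)] ql[OF pt(1)] by (simp add: z_def)
      \<comment> \<open>The difference operator expresses the value at the corner by the values at the other points.\<close>
      have lin: "\<phi> i (grid_point ?o) = (\<Sum>p\<in>G. - grid_weight y p * \<phi> i (grid_point p))" if "i < n" for i
      proof -
        have "?o \<in> grid y" by (simp add: grid_def)
        moreover have "grid_weight y ?o = 1" by (simp add: grid_weight_def)
        ultimately show ?thesis
          using sum_grid_weight_hform[OF psd(2)[OF that] l(3) \<open>y > 0\<close>]
          by (simp add: sum.remove[of "grid y" ?o] G_def sum_negf)
      qed
      have "z ?o = (\<lambda>i. \<Sum>p\<in>G. - grid_weight y p * z p i)"
        by (auto simp: z_def lin fun_eq_iff)
      then have "W (z ?o) \<le> 2 ^ card G * (\<Sum>p\<in>G. (- grid_weight y p)\<^sup>2 * W (z p))"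
        using psd_quadratic_sum_le[OF psd(1), of G z "\<lambda>p. - grid_weight y p"]
        by (simp add: G_def z_def Rn_def)
      then show False using f(3) by (simp add: Wz)
    qed
  qed
  moreover have "nonneg_form m q" by (simp add: nonneg_form_def q(2) f(2))
  ultimately show ?thesis using q(1) by blast
qed

end
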